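(* Let $\beta_2\ge0$, $K_0<0$, $K_2<0$, $\theta\in(0,\tfrac{\pi}{6})$ and $c_0>0$. Consider the real system (T) for $(\mathbf{A},\mathbf{B})=(A_1,A_2,A_3,B_1,B_2,B_3)\in\mathbb{R}^6$. (i) If $K_2<K_0$, then for every $\mu_0>0$ there exists a heteroclinic orbit $(\mathbf{A}_{H_-\to T},\mathbf{B}_{H_-\to T})$ of (T) such that $$\lim_{\Xi\to-\infty}(\mathbf{A}_{H_-\to T},\mathbf{B}_{H_-\to T})(\Xi)=(\mathbf{A}_{H_-},\mathbf{0})\quad\text{and}\quad\lim_{\Xi\to+\infty}(\mathbf{A}_{H_-\to T},\mathbf{B}_{H_-\to T})(\Xi)=(\mathbf{A}_T,\mathbf{0}).$$ (ii) If $K_2\in(K_0,0)$, set $$\mu_1=-\frac{\beta_2^2K_0}{2\sqrt2\sqrt{K_0(K_0+K_2)^3}-2K_0(K_0+3K_2)}.$$ For every $\mu_0\in(0,\mu_1)$ there exists a heteroclinic orbit of (T) from $(\mathbf{A}_{H_-},\mathbf{0})$ (as $\Xi\to-\infty$) to $(\mathbf{A}_T,\mathbf{0})$ (as $\Xi\to+\infty$) as in (i), and for every $\mu_0>\mu_1$ there exists a heteroclinic orbit $(\mathbf{A}_{R\to T},\mathbf{B}_{R\to T})$ of (T) such that $$\lim_{\Xi\to-\infty}(\mathbf{A}_{R\to T},\mathbf{B}_{R\to T})(\Xi)=(\mathbf{A}_R,\mathbf{0})\quad\text{and}\quad\lim_{\Xi\to+\infty}(\mathbf{A}_{R\to T},\mathbf{B}_{R\to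 T})(\Xi)=(\mathbf{A}_T,\mathbf{0}).$$
   Context: $\mathbf{d}=(\cos\theta,\sin\theta)$, $\mathbf{k}_1=(1,0)$, $\mathbf{k}_2=\tfrac12(-1,\sqrt3)$, $\mathbf{k}_3=-\tfrac12(1,\sqrt3)$. System (T): for $\{j,l,m\}=\{1,2,3\}$, $$\partial_\Xi A_j=B_j,\qquad 4(\mathbf{d}\cdot\mathbf{k}_j)^2\,\partial_\Xi B_j=-\mu_0A_j-c_0B_j-\beta_2A_lA_m-\big(K_0A_j^2+K_2(A_l^2+A_m^2)\big)A_j,$$ with real parameters $\mu_0,c_0,\beta_2,K_0,K_2$ and real-valued unknowns. Equilibria: $\mathbf{A}_T=(0,0,0)$ (trivial state); $\mathbf{A}_R=(\pm\sqrt{-\mu_0/K_0},0,0)$ (roll waves, $\mu_0K_0<0$); $\mathbf{A}_{H_-}=(a,a,a)$ with $a=\dfrac{-\beta_2+\sqrt{\beta_2^2-4\mu_0(K_0+2K_2)}}{2(K_0+2K_2)}$ (down-hexagons, $a<0$ for $\mu_0>0$ in the parameter regime considered). *)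

theory Defs
  imports "HOL-Analysis.Analysis"
begin

definition dvec :: "real \<Rightarrow> real ^ 2" where
  "dvec \<theta> = vector [cos \<theta>, sin \<theta>]"

definition kvec :: "3 \<Rightarrow> real ^ 2" where
  "kvec j =
    (if j = 1 then vector [1, 0]
     else if j = 2 then (1 / 2) *\<^sub>R vector [-1, sqrt 3]
     else - ((1 / 2) *\<^sub>R vector [1, sqrt 3]))"

text \<open>
  \<open>(A, B)\<close> is a solution of the system (T), defined on all of \<open>\<real>\<close>. The condition
  \<open>{j, l, m} = UNIV\<close> on the index type \<open>3\<close> says that \<open>(j, l, m)\<close> is a permutation of \<open>(1, 2, 3)\<close>.
\<close>

definition solution_T ::
  "real \<Rightarrow> real \<Rightarrow> real \<Rightarrow> real \<Rightarrow> real \<Rightarrow> real \<Rightarrow> (real \<Rightarrow> real ^ 3) \<Rightarrow> (real \<Rightarrow> real ^ 3) \<Rightarrow> bool"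
where
  "solution_T \<theta> \<mu>0 c0 \<beta>2 K0 K2 A B \<longleftrightarrow>
    (\<forall>\<xi>. \<forall>j l m. {j, l, m} = (UNIV :: 3 set) \<longrightarrow>
      ((\<lambda>x. A x $ j) has_real_derivative B \<xi> $ j) (at \<xi>) \<and>
      (\<exists>B'. ((\<lambda>x. B x $ j) has_real_derivative B') (at \<xi>) \<and>
        4 * (dvec \<theta> \<bullet> kvec j)\<^sup>2 * B' =
          - \<mu>0 * A \<xi> $ j - c0 * B \<xi> $ j - \<beta>2 * A \<xi> $ l * A \<xi> $ m
          - (K0 * (A \<xi> $ j)\<^sup>2 + K2 * ((A \<xi> $ l)\<^sup>2 + (A \<xi> $ m)\<^sup>2)) * A \<xi> $ j))"

definition equilibrium_T ::
  "real \<Rightarrow> real \<Rightarrow> real \<Rightarrow> real \<Rightarrow> real \<Rightarrow> real \<Rightarrow> (real ^ 3) \<times> (real ^ 3) \<Rightarrow> bool"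
where
  "equilibrium_T \<theta> \<mu>0 c0 \<beta>2 K0 K2 p \<longleftrightarrow>
    solution_T \<theta> \<mu>0 c0 \<beta>2 K0 K2 (\<lambda>_. fst p) (\<lambda>_. snd p)"

text \<open>
  A heteroclinic orbit from \<open>p\<close> (at \<open>-\<infinity>\<close>) to \<open>q\<close> (at \<open>+\<infinity>\<close>): a global solution connecting two
  distinct equilibria.
\<close>

definition heteroclinic_T ::
  "real \<Rightarrow> real \<Rightarrow> real \<Rightarrow> real \<Rightarrow> real \<Rightarrow> real \<Rightarrow> (real ^ 3) \<times> (real ^ 3) \<Rightarrow> (real ^ 3) \<times> (real ^ 3) \<Rightarrow>
    (real \<Rightarrow> real ^ 3) \<Rightarrow> (real \<Rightarrow> real ^ 3) \<Rightarrow> bool"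
where
  "heteroclinic_T \<theta> \<mu>0 c0 \<beta>2 K0 K2 p q A B \<longleftrightarrow>
    equilibrium_T \<theta> \<mu>0 c0 \<beta>2 K0 K2 p \<and> equilibrium_T \<theta> \<mu>0 c0 \<beta>2 K0 K2 q \<and> p \<noteq> q \<and>
    solution_T \<theta> \<mu>0 c0 \<beta>2 K0 K2 A B \<and>
    ((\<lambda>\<xi>. (A \<xi>, B \<xi>)) \<longlongrightarrow> p) at_bot \<and>
    ((\<lambda>\<xi>. (A \<xi>, B \<xi>)) \<longlongrightarrow> q) at_top"

definition A_T :: "real ^ 3" where
  "A_T = vector [0, 0, 0]"

text \<open>Roll waves; \<open>s \<in> {1, -1}\<close> is the choice of sign in \<open>\<plusminus>\<close>.\<close>

definition A_R :: "real \<Rightarrow> real \<Rightarrow> real \<Rightarrow> real ^ 3" where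
  "A_R s \<mu>0 K0 = vector [s * sqrt (- \<mu>0 / K0), 0, 0]"

definition A_H_minus :: "real \<Rightarrow> real \<Rightarrow> real \<Rightarrow> real \<Rightarrow> real ^ 3" where
  "A_H_minus \<mu>0 \<beta>2 K0 K2 =
    (let a = (- \<beta>2 + sqrt (\<beta>2\<^sup>2 - 4 * \<mu>0 * (K0 + 2 * K2))) / (2 * (K0 + 2 * K2))
     in vector [a, a, a])"

definition \<mu>1 :: "real \<Rightarrow> real \<Rightarrow> real \<Rightarrow> real" where
  "\<mu>1 \<beta>2 K0 K2 =
    - (\<beta>2\<^sup>2 * K0) / (2 * sqrt 2 * sqrt (K0 * (K0 + K2) ^ 3) - 2 * K0 * (K0 + 3 * K2))"

end

theory Submission
  imports Defs
begin

text \<open>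
  System (T) is the motion of a particle with mass matrix \<open>diag (mass \<theta> j)\<close> in the potential
  \<open>V = T_potential\<close>, slowed down by the friction \<open>c0\<close>. The energy decreases strictly along every orbit
  that is not at rest, and for \<open>\<mu>0 > 0\<close> the origin is the bottom of a potential well.

  The general principle is \<open>heteroclinic_connection\<close>: let \<open>p\<close> be an isolated critical point on the rim of a
  bounded well around the origin, such that the potential on the rim is nowhere below \<open>V p\<close> and the
  origin is the only critical point of the well below the level \<open>V p\<close>. A particle released at rest inside
  the well, close to \<open>p\<close> and below its level, can neither cross the rim nor stop before the origin.
  Take release points tending to \<open>p\<close>, and restart the clock when the orbit leaves a small ball around \<open>p\<close>:
  the time spent in the ball tends to infinity, so a limit of the exit states lies on an orbit that has
  been in the ball since \<open>-\<infinity>\<close>. By the invariance principle of LaSalle that orbit comes from \<open>p\<close>, and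
  it goes to the origin. This compactness argument replaces the unstable manifold of \<open>p\<close>; it uses only
  the global flow of a Lipschitz vector field, built first.

  Since \<open>V\<close> is a sum of homogeneous terms of degrees 2, 3 and 4, on every ray from the origin it increases up
  to the only critical point of the ray and decreases afterwards. A critical point \<open>q \<noteq> 0\<close> is therefore
  the maximum of \<open>V\<close> on its ray, and every surface that meets the ray gives a lower bound for \<open>V q\<close>. So the
  principle applies as soon as there is a star-shaped surface \<open>N = 1\<close> through \<open>p\<close> with
  \<open>V \<ge> V p\<close> on it (\<open>quartic_heteroclinic_connection\<close>). There remains the choice of the surface for the
  hexagon \<open>(-h, -h, -h)\<close>.

  If \<open>K2 < K0\<close>, a sphere works: on it both the cubic and the quartic term are least at the hexagons
  (\<open>hexagon_barrier_sphere\<close>).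

  If \<open>K0 < K2 < 0\<close>, put \<open>r = sqrt (2 * (1 + K2 / K0))\<close>, which lies between 1 and 2. In units of \<open>h\<close>, and with \<open>x\<close>
  the component of largest modulus, the surface is \<open>x\<^sup>2 + r / 2 * (y\<^sup>2 + z\<^sup>2) = 1 + r\<close>. It passes
  through the hexagons and, when \<open>\<mu>0 = \<mu>1\<close>, through the rolls; at this threshold the excess of \<open>V\<close> over
  the hexagon level on the part \<open>y = z\<close> of the surface is a positive multiple of
  \<open>y\<^sup>2 * (x - 1)\<^sup>2\<close> (\<open>hexagon_barrier_ordered\<close>). The condition \<open>\<mu>0 < \<mu>1\<close> says that the scaled
  coefficient \<open>\<beta>2 / (- K0 * h)\<close> exceeds its threshold value \<open>(2 - r) * (1 + r)\<close>
  (\<open>hexagons_below_rolls\<close>), and then \<open>V\<close> rises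
  even further above the hexagon level.

  For the rolls the line \<open>A\<^sub>2 = A\<^sub>3 = 0\<close> is invariant, and the principle in dimension one gives the
  connection for every \<open>\<mu>0 > 0\<close>.
\<close>

section \<open>The flow of a Lipschitz vector field\<close>

lemma norm_integral_exp_bound:
  fixes F :: "real \<Rightarrow> 'a::euclidean_space"
  assumes "k > 0" "t \<ge> 0" "C \<ge> 0" "continuous_on {0..t} F"
    and "\<And>s. s \<in> {0..t} \<Longrightarrow> norm (F s) \<le> C * exp (k * s)"
  shows "norm (integral {0..t} F) \<le> C / k * exp (k * t)"
proof -
  have "((\<lambda>s. C * exp (k * s)) has_integral (C / k * exp (k * t) - C / k * exp (k * 0))) {0..t}"
    using assms by (intro fundamental_theorem_of_calculus)
      (auto intro!: derivative_eq_intros simp flip: has_real_derivative_iff_has_vector_derivative)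
  moreover have "norm (integral {0..t} F) \<le> integral {0..t} (\<lambda>s. C * exp (k * s))"
    using assms by (intro integral_norm_bound_integral integrable_continuous_interval continuous_intros) auto
  moreover have "C / k \<ge> 0" using assms by auto
  ultimately have "norm (integral {0..t} F) \<le> C / k * exp (k * t) - C / k * exp (k * 0)"
    by (simp only: integral_unique)
  then show ?thesis using \<open>C / k \<ge> 0\<close> by simp
qed

text \<open>
  Picard iteration in the weighted norm \<open>sup (exp (- k * t) * norm (x t))\<close>: for \<open>k\<close> above the Lipschitz
  constant the integral operator is a contraction on the whole half-line, so no gluing of local
  solutions is needed. In the proof \<open>g t\<close> stands for \<open>exp (- k * t) *\<^sub>R x t\<close>, and \<open>max 0 t\<close> extends it to
  negative times so that it lives in the Banach space of bounded continuous functions on the line.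
\<close>

lemma picard_forward:
  fixes f :: "'a::euclidean_space \<Rightarrow> 'a"
  assumes L: "L-lipschitz_on UNIV f"
  shows "\<exists>x. x 0 = x0 \<and> (\<forall>t\<ge>0. (x has_vector_derivative f (x t)) (at t within {0..}))"
proof -
  have L0: "L \<ge> 0" and Lip: "\<And>a b. norm (f a - f b) \<le> L * norm (a - b)"
    using L lipschitz_onD[OF L] lipschitz_on_nonneg[OF L] by (auto simp: dist_norm)
  define k where "k = L + 1"
  have k: "k > 0" using L0 by (simp add: k_def)
  define F where "F g s = f (exp (k * s) *\<^sub>R apply_bcontfun g s)" for g :: "real \<Rightarrow>\<^sub>C 'a" and s
  define I where "I g t = integral {0..t} (F g)" for g t
  define \<Phi> where "\<Phi> g t = exp (- k * max 0 t) *\<^sub>R (x0 + I g (max 0 t))" for g t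
  have cF: "continuous_on S (F g)" for S g
  proof -
    have "continuous_on UNIV f" using L by (rule lipschitz_on_continuous_on)
    then show ?thesis unfolding F_def
      by (rule continuous_on_compose2[of UNIV f]) (auto intro!: continuous_intros)
  qed
  have dI: "(I g has_vector_derivative F g t) (at t within {0..})" if "t \<ge> 0" for g t
  proof -
    have "((\<lambda>u. integral {0..u} (F g)) has_vector_derivative F g t) (at t within {0..t+1})"
      using that by (intro integral_has_vector_derivative cF) auto
    moreover have "at t within {0..t+1} = at t within {0..}"
      using that by (intro at_within_nhd[of _ "{..<t+1}"]) auto
    ultimately show ?thesis unfolding I_def by simp
  qed
  have cI: "continuous_on {0..} (I g)" for g
    unfolding continuous_on_eq_continuous_within
    using dI has_vector_derivative_continuous by fastforce
  have bI: "norm (I g t) \<le> (norm (f 0) + L * norm g) / k * exp (k * t)" if "t \<ge> 0" for g t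
    unfolding I_def
  proof (rule norm_integral_exp_bound)
    fix s assume s: "s \<in> {0..t}"
    have "norm (F g s) \<le> norm (f 0) + norm (f (exp (k * s) *\<^sub>R apply_bcontfun g s) - f 0)"
      unfolding F_def by (metis norm_triangle_sub)
    also have "\<dots> \<le> norm (f 0) + L * (exp (k * s) * norm (apply_bcontfun g s))"
      using Lip[of "exp (k * s) *\<^sub>R apply_bcontfun g s" 0] by simp
    also have "\<dots> \<le> norm (f 0) * exp (k * s) + L * (exp (k * s) * norm g)"
    proof (intro add_mono mult_left_mono)
      show "norm (f 0) \<le> norm (f 0) * exp (k * s)"
        using s k mult_left_mono[of 1 "exp (k * s)" "norm (f 0)"] by simp
      show "norm (apply_bcontfun g s) \<le> norm g" by (rule norm_bounded)
    qed (use L0 in auto)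
    finally show "norm (F g s) \<le> (norm (f 0) + L * norm g) * exp (k * s)"
      by (simp add: algebra_simps)
  qed (use that k L0 in \<open>simp_all add: cF\<close>)
  have \<Phi>b: "\<Phi> g \<in> bcontfun" for g
  proof (rule bcontfun_normI)
    show "continuous_on UNIV (\<Phi> g)" unfolding \<Phi>_def
      by (intro continuous_on_scaleR continuous_on_add continuous_on_compose2[OF cI]) (auto intro!: continuous_intros)
    fix t :: real
    let ?m = "max 0 t" and ?C = "(norm (f 0) + L * norm g) / k"
    have "norm (\<Phi> g t) \<le> exp (- k * ?m) * (norm x0 + ?C * exp (k * ?m))"
      unfolding \<Phi>_def using bI[of ?m g]
      by (auto intro!: norm_triangle_mono mult_left_mono)
    also have "\<dots> = exp (- k * ?m) * norm x0 + ?C * (exp (- k * ?m) * exp (k * ?m))"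
      by (simp only: algebra_simps)
    also have "exp (- k * ?m) * exp (k * ?m) = 1" by (simp flip: exp_add)
    also have "exp (- k * ?m) * norm x0 + ?C * 1 \<le> norm x0 + ?C"
      using k mult_right_mono[of "exp (- k * ?m)" 1 "norm x0"] by simp
    finally show "norm (\<Phi> g t) \<le> norm x0 + ?C" .
  qed
  have contr: "dist (Bcontfun (\<Phi> g)) (Bcontfun (\<Phi> h)) \<le> (L / k) * dist g h" for g h
  proof (rule dist_bound)
    fix t :: real
    let ?m = "max 0 t"
    have "I g ?m - I h ?m = integral {0..?m} (\<lambda>s. F g s - F h s)"
      unfolding I_def by (intro integral_diff[symmetric] integrable_continuous_interval cF)
    moreover have "norm (integral {0..?m} (\<lambda>s. F g s - F h s)) \<le> (L * dist g h) / k * exp (k * ?m)"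
    proof (rule norm_integral_exp_bound)
      fix s
      have "norm (F g s - F h s) \<le> L * norm (exp (k * s) *\<^sub>R apply_bcontfun g s - exp (k * s) *\<^sub>R apply_bcontfun h s)"
        unfolding F_def by (rule Lip)
      also have "\<dots> = L * (exp (k * s) * dist (apply_bcontfun g s) (apply_bcontfun h s))"
        by (simp add: dist_norm flip: scaleR_diff_right)
      also have "\<dots> \<le> L * (exp (k * s) * dist g h)"
        using L0 by (intro mult_left_mono dist_bounded) auto
      finally show "norm (F g s - F h s) \<le> (L * dist g h) * exp (k * s)" by (simp add: algebra_simps)
    qed (use k L0 cF in \<open>auto intro!: continuous_intros\<close>)
    ultimately have *: "norm (I g ?m - I h ?m) \<le> (L * dist g h) / k * exp (k * ?m)" by simp
    have "dist (\<Phi> g t) (\<Phi> h t) = exp (- k * ?m) * norm (I g ?m - I h ?m)"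
      unfolding \<Phi>_def dist_norm by (simp flip: scaleR_diff_right)
    also have "\<dots> \<le> exp (- k * ?m) * ((L * dist g h) / k * exp (k * ?m))"
      by (rule mult_left_mono[OF *]) simp
    also have "\<dots> = L / k * dist g h * (exp (- k * ?m) * exp (k * ?m))" by simp
    also have "exp (- k * ?m) * exp (k * ?m) = 1" by (simp flip: exp_add)
    also have "L / k * dist g h * 1 = L / k * dist g h" by simp
    finally show "dist (apply_bcontfun (Bcontfun (\<Phi> g)) t) (apply_bcontfun (Bcontfun (\<Phi> h)) t) \<le> L / k * dist g h"
      by (simp add: Bcontfun_inverse[OF \<Phi>b])
  qed
  have "\<exists>!g. Bcontfun (\<Phi> g) = g"
    using k L0 contr by (intro banach_fix_type[of "L / k"]) (auto simp: k_def)
  then obtain g where g: "Bcontfun (\<Phi> g) = g" by blast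
  define x where "x t = x0 + I g t" for t
  have xg: "exp (k * t) *\<^sub>R apply_bcontfun g t = x t" if "t \<ge> 0" for t
  proof -
    have "apply_bcontfun g t = \<Phi> g t" using Bcontfun_inverse[OF \<Phi>b, of g] g by simp
    then show ?thesis using that unfolding \<Phi>_def x_def by (simp flip: exp_add)
  qed
  have "(x has_vector_derivative f (x t)) (at t within {0..})" if "t \<ge> 0" for t
    using dI[OF that, of g] xg[OF that]
    unfolding x_def[abs_def] F_def by (auto intro!: derivative_eq_intros)
  moreover have "x 0 = x0" unfolding x_def I_def by simp
  ultimately show ?thesis by blast
qed

lemma picard_global:
  fixes f :: "'a::euclidean_space \<Rightarrow> 'a"
  assumes L: "L-lipschitz_on UNIV f"
  shows "\<exists>x. x 0 = x0 \<and> (\<forall>t. (x has_vector_derivative f (x t)) (at t))"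
proof -
  obtain y where y: "y 0 = x0" "\<And>t. t \<ge> 0 \<Longrightarrow> (y has_vector_derivative f (y t)) (at t within {0..})"
    using picard_forward[OF L] by blast
  have L': "L-lipschitz_on UNIV (\<lambda>a. - f a)" using L by (simp add: lipschitz_on_def dist_minus)
  obtain z where z: "z 0 = x0" "\<And>t. t \<ge> 0 \<Longrightarrow> (z has_vector_derivative - f (z t)) (at t within {0..})"
    using picard_forward[OF L'] by blast
  define x where "x t = (if t \<in> {0..} then y t else z (- t))" for t :: real
  have zr: "((\<lambda>t. z (- t)) has_vector_derivative f (z (- t))) (at t within {..0})" if "t \<le> 0" for t
  proof -
    have "(z has_vector_derivative - f (z (- t))) (at (- t) within uminus ` {..0})"
      using z(2)[of "- t"] that by simp
    then have "((z \<circ> uminus) has_vector_derivative (- 1) *\<^sub>R - f (z (- t))) (at t within {..0})"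
      by (intro vector_diff_chain_within) (auto intro!: derivative_eq_intros)
    then show ?thesis by (simp add: o_def)
  qed
  have "(x has_vector_derivative f (x t)) (at t)" for t
  proof -
    have "(x has_vector_derivative (if t \<in> {0..} then f (y t) else f (z (- t)))) (at t within UNIV)"
      unfolding x_def
      by (rule has_vector_derivative_If_within_closures[where T = "{..0}"])
        (use y z(1) zr[of t] in \<open>auto simp: Un_absorb1 Un_absorb2 insert_absorb\<close>)
    then show ?thesis by (auto simp: x_def split: if_splits)
  qed
  moreover have "x 0 = x0" by (simp add: x_def y)
  ultimately show ?thesis by auto
qed

text \<open>
  Differential form of the Gronwall inequality: \<open>exp (- 2 * L * t)\<close> times the squared distance of two
  solutions is nonincreasing.
\<close>

lemma lipschitz_ode_dist_forward:
  fixes f :: "'a::real_inner \<Rightarrow> 'a"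
  assumes L: "L-lipschitz_on UNIV f"
    and x: "\<And>t. (x has_vector_derivative f (x t)) (at t)"
    and y: "\<And>t. (y has_vector_derivative f (y t)) (at t)"
    and t: "t \<ge> 0"
  shows "dist (x t) (y t) \<le> exp (L * t) * dist (x 0) (y 0)"
proof -
  define u where "u s = exp (- 2 * L * s) * ((x s - y s) \<bullet> (x s - y s))" for s
  have "u t \<le> u 0"
  proof (rule DERIV_nonpos_imp_nonincreasing[OF t])
    fix s :: real
    let ?D = "exp (- 2 * L * s) * (2 * ((x s - y s) \<bullet> (f (x s) - f (y s))) - 2 * L * ((x s - y s) \<bullet> (x s - y s)))"
    have "(u has_real_derivative ?D) (at s)"
      using x[of s] y[of s] unfolding u_def has_vector_derivative_def has_field_derivative_def
      by (auto intro!: derivative_eq_intros simp: algebra_simps inner_commute)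
    moreover have "(x s - y s) \<bullet> (f (x s) - f (y s)) \<le> norm (x s - y s) * norm (f (x s) - f (y s))"
      by (rule norm_cauchy_schwarz)
    moreover have "\<dots> \<le> norm (x s - y s) * (L * norm (x s - y s))"
      using lipschitz_onD[OF L, of "x s" "y s"] by (intro mult_left_mono) (auto simp: dist_norm)
    ultimately have "?D \<le> 0"
      by (auto simp: mult_le_0_iff power2_eq_square dot_square_norm mult.left_commute)
    with \<open>(u has_real_derivative ?D) (at s)\<close> show "\<exists>d. (u has_real_derivative d) (at s) \<and> d \<le> 0" by blast
  qed
  then have "(x t - y t) \<bullet> (x t - y t) \<le> exp (2 * L * t) * ((x 0 - y 0) \<bullet> (x 0 - y 0))"
    unfolding u_def by (simp add: exp_minus field_simps)
  also have "\<dots> = (exp (L * t) * norm (x 0 - y 0))\<^sup>2"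
    by (simp add: power_mult_distrib dot_square_norm flip: exp_double)
  finally show ?thesis
    by (simp add: dist_norm dot_square_norm power2_le_iff_abs_le)
qed

lemma reverse_time_vector_derivative:
  assumes "(x has_vector_derivative v) (at (- t))"
  shows "((\<lambda>t. x (- t)) has_vector_derivative - v) (at t)"
proof -
  have "((x \<circ> uminus) has_vector_derivative (- 1) *\<^sub>R v) (at t)"
    using assms by (intro vector_diff_chain_at) (auto intro!: derivative_eq_intros)
  then show ?thesis by (simp add: o_def)
qed

lemma lipschitz_ode_dist:
  fixes f :: "'a::real_inner \<Rightarrow> 'a"
  assumes L: "L-lipschitz_on UNIV f"
    and x: "\<And>t. (x has_vector_derivative f (x t)) (at t)"
    and y: "\<And>t. (y has_vector_derivative f (y t)) (at t)"
  shows "dist (x t) (y t) \<le> exp (L * \<bar>t\<bar>) * dist (x 0) (y 0)"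
proof (cases "t \<ge> 0")
  case True
  then show ?thesis using lipschitz_ode_dist_forward[OF assms] by simp
next
  case False
  have "L-lipschitz_on UNIV (\<lambda>a. - f a)" using L by (simp add: lipschitz_on_def dist_minus)
  from lipschitz_ode_dist_forward[OF this, of "\<lambda>t. x (- t)" "\<lambda>t. y (- t)" "- t"] False
  show ?thesis using reverse_time_vector_derivative[OF x] reverse_time_vector_derivative[OF y] by simp
qed

theorem lipschitz_flow:
  fixes f :: "'a::euclidean_space \<Rightarrow> 'a"
  assumes L: "L-lipschitz_on UNIV f"
  obtains \<phi> :: "real \<Rightarrow> 'a \<Rightarrow> 'a" where
    "\<And>x. \<phi> 0 x = x"
    "\<And>x t. ((\<lambda>t. \<phi> t x) has_vector_derivative f (\<phi> t x)) (at t)"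
    "\<And>s t x. \<phi> s (\<phi> t x) = \<phi> (s + t) x"
    "\<And>t x y. dist (\<phi> t x) (\<phi> t y) \<le> exp (L * \<bar>t\<bar>) * dist x y"
proof -
  obtain \<psi> where \<psi>: "\<And>x. \<psi> x 0 = x" "\<And>x t. (\<psi> x has_vector_derivative f (\<psi> x t)) (at t)"
    using picard_global[OF L] by metis
  have grp: "\<psi> (\<psi> x t) s = \<psi> x (s + t)" for x s t
  proof -
    have "((\<lambda>s. \<psi> x (s + t)) has_vector_derivative f (\<psi> x (s + t))) (at s)" for s
    proof -
      have "((\<psi> x \<circ> (\<lambda>s. s + t)) has_vector_derivative 1 *\<^sub>R f (\<psi> x (s + t))) (at s)"
        using \<psi>(2)[of x "s + t"] by (intro vector_diff_chain_at) (auto intro!: derivative_eq_intros)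
      then show ?thesis by (simp add: o_def)
    qed
    from lipschitz_ode_dist[OF L \<psi>(2)[of "\<psi> x t"] this, of s] show ?thesis by (simp add: \<psi>(1))
  qed
  show ?thesis
    by (rule that[of "\<lambda>t x. \<psi> x t"])
      (use \<psi> grp lipschitz_ode_dist[OF L \<psi>(2) \<psi>(2)] in auto)
qed

section \<open>Invariance principle and first exit times\<close>

text \<open>
  If \<open>y\<close> is a limit point of the orbit, the monotone limit of \<open>E\<close> along the orbit is the value of \<open>E\<close> on the
  whole forward orbit of \<open>y\<close>. Hence all limit points are equal to \<open>q\<close>, and in a compact set this forces
  convergence. The lemma is used for both time directions, the flow being reversible.
\<close>

lemma lasalle_convergence:
  fixes \<phi> :: "real \<Rightarrow> 'a::metric_space \<Rightarrow> 'a" and E :: "'a \<Rightarrow> real"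
  assumes flow: "\<And>s t x. \<phi> s (\<phi> t x) = \<phi> (s + t) x"
    and cont: "\<And>s. continuous_on UNIV (\<phi> s)"
    and K: "compact K" "\<And>t. t \<ge> 0 \<Longrightarrow> \<phi> t x \<in> K"
    and E: "continuous_on K E"
    and mono: "\<And>s t. 0 \<le> s \<Longrightarrow> s \<le> t \<Longrightarrow> E (\<phi> t x) \<le> E (\<phi> s x)"
    and rest: "\<And>y. y \<in> K \<Longrightarrow> (\<And>s. s \<ge> 0 \<Longrightarrow> \<phi> s y \<in> K \<and> E (\<phi> s y) = E y) \<Longrightarrow> y = q"
  shows "((\<lambda>t. \<phi> t x) \<longlongrightarrow> q) at_top"
proof (rule ccontr)
  assume "\<not> ?thesis"
  then obtain e where e: "e > 0" "\<not> (\<forall>\<^sub>F t in at_top. dist (\<phi> t x) q < e)"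
    unfolding tendsto_iff by blast
  then have "\<exists>t\<ge>real n. dist (\<phi> t x) q \<ge> e" for n
    unfolding eventually_at_top_linorder by (meson not_le)
  then obtain t where t: "\<And>n. t n \<ge> real n" "\<And>n. dist (\<phi> (t n) x) q \<ge> e" by metis
  have t0: "t n \<ge> 0" for n using t(1)[of n] by linarith
  obtain y r where yK: "y \<in> K" and r: "strict_mono (r :: nat \<Rightarrow> nat)"
    and lim: "((\<lambda>n. \<phi> (t n) x) \<circ> r) \<longlonglongrightarrow> y"
    using K t0 unfolding compact_def by metis
  define u where "u n = t (r n)" for n
  have u0: "u n \<ge> 0" for n using t0 by (simp add: u_def)
  have un: "u n \<ge> real n" for n
    using t(1)[of "r n"] seq_suble[OF r, of n] unfolding u_def by linarith
  have lim: "(\<lambda>n. \<phi> (u n) x) \<longlonglongrightarrow> y" using lim by (simp add: u_def o_def)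
  have "dist y q \<ge> e"
    using t(2) by (intro tendsto_lowerbound[OF tendsto_dist[OF lim tendsto_const]]) (auto simp: u_def)
  have "y = q"
  proof (rule rest[OF yK])
    fix s :: real assume s: "s \<ge> 0"
    have "(\<lambda>n. \<phi> s (\<phi> (u n) x)) \<longlonglongrightarrow> \<phi> s y"
      by (rule continuous_on_tendsto_compose[OF cont lim]) auto
    then have lims: "(\<lambda>n. \<phi> (s + u n) x) \<longlonglongrightarrow> \<phi> s y" by (simp add: flow)
    have inK: "\<phi> (s + u n) x \<in> K" for n using K(2) s u0 by simp
    have sK: "\<phi> s y \<in> K"
      using closed_sequentially[OF compact_imp_closed[OF K(1)] _ lims] inK by blast
    have Es: "(\<lambda>n. E (\<phi> (s + u n) x)) \<longlonglongrightarrow> E (\<phi> s y)"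
      by (rule continuous_on_tendsto_compose[OF E lims sK]) (use inK in auto)
    have E0: "(\<lambda>n. E (\<phi> (u n) x)) \<longlonglongrightarrow> E y"
      by (rule continuous_on_tendsto_compose[OF E lim yK]) (use K(2) u0 in auto)
    have "E (\<phi> s y) \<le> E y"
      by (rule LIMSEQ_le[OF Es E0]) (use mono s u0 in auto)
    \<comment> \<open>the times \<open>u j\<close> eventually exceed \<open>s + u n\<close>, so monotonicity also works the other way\<close>
    moreover have "E y \<le> E (\<phi> (s + u n) x)" for n
    proof (rule tendsto_upperbound[OF E0])
      obtain k :: nat where "s + u n \<le> real k" using real_arch_simple by blast
      then have "E (\<phi> (u j) x) \<le> E (\<phi> (s + u n) x)" if "j \<ge> k" for j
        using un[of j] that u0[of n] s by (intro mono) auto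
      then show "\<forall>\<^sub>F j in sequentially. E (\<phi> (u j) x) \<le> E (\<phi> (s + u n) x)"
        unfolding eventually_sequentially by blast
    qed auto
    then have "E y \<le> E (\<phi> s y)"
      by (intro tendsto_lowerbound[OF Es]) auto
    ultimately show "\<phi> s y \<in> K \<and> E (\<phi> s y) = E y" using sK by simp
  qed
  with \<open>dist y q \<ge> e\<close> e show False by simp
qed

lemma first_exit:
  fixes z :: "real \<Rightarrow> 'a::topological_space"
  assumes z: "continuous_on {0..} z" and U: "open U" and "z 0 \<in> U" "t1 \<ge> 0" "z t1 \<notin> U"
  obtains t where "0 < t" "t \<le> t1" "z t \<notin> U" "z t \<in> closure U" "\<And>s. 0 \<le> s \<Longrightarrow> s < t \<Longrightarrow> z s \<in> U"
proof -
  let ?S = "{0..t1} \<inter> z -` (- U)"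
  have "closed ?S"
    using z U by (intro continuous_closed_preimage) (auto intro: continuous_on_subset)
  then have "compact ?S"
    by (auto simp: compact_eq_bounded_closed intro: bounded_subset[OF bounded_closed_interval])
  moreover have "?S \<noteq> {}" using assms by auto
  ultimately obtain t where t: "t \<in> ?S" "\<And>s. s \<in> ?S \<Longrightarrow> t \<le> s"
    by (metis compact_attains_inf)
  have before: "z s \<in> U" if "0 \<le> s" "s < t" for s using t that by force
  have "t \<noteq> 0" using t assms by auto
  then have "0 < t" using t by auto
  have "z ` closure {0..<t} \<subseteq> closure U"
    using before \<open>0 < t\<close> closure_subset[of U]
    by (intro image_closure_subset) (auto intro: continuous_on_subset[OF z])
  then have "z t \<in> closure U" using \<open>0 < t\<close> by auto
  with that[of t] t before \<open>0 < t\<close> show ?thesis by auto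
qed

section \<open>Heteroclinic orbits of damped gradient systems\<close>

text \<open>
  Newton's equation \<open>M a = - c *\<^sub>R v - G x\<close> for position \<open>x\<close>, velocity \<open>v\<close> and acceleration \<open>a\<close>, with
  mass matrix \<open>M\<close>; states are pairs \<open>(x, v)\<close>. The inverse \<open>W\<close> of \<open>M\<close> is a parameter so that instances can name it explicitly.
\<close>

locale damped_gradient_system =
  fixes V :: "'a::euclidean_space \<Rightarrow> real" and G M W :: "'a \<Rightarrow> 'a" and c m :: real
  assumes gradient: "(V has_derivative (\<lambda>h. G x \<bullet> h)) (at x)"
    and G_lipschitz: "\<exists>L. L-lipschitz_on (cball 0 R) G"
    and linear_M: "linear M" and linear_W: "linear W"
    and M_sym: "x \<bullet> M y = M x \<bullet> y" and MW: "M (W x) = x"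
    and m_pos: "m > 0" and M_coercive: "m * (x \<bullet> x) \<le> x \<bullet> M x"
    and c_pos: "c > 0"
begin

definition field :: "'a \<times> 'a \<Rightarrow> 'a \<times> 'a" where
  "field z = (snd z, W (- c *\<^sub>R snd z - G (fst z)))"

definition energy :: "'a \<times> 'a \<Rightarrow> real" where
  "energy z = (snd z \<bullet> M (snd z)) / 2 + V (fst z)"

lemma V_le_energy: "V (fst z) \<le> energy z"
proof -
  have "0 \<le> m * (snd z \<bullet> snd z)" using m_pos by simp
  also have "\<dots> \<le> snd z \<bullet> M (snd z)" by (rule M_coercive)
  finally show ?thesis by (simp add: energy_def)
qed

lemma continuous_V: "continuous_on S V"
  using gradient by (meson continuous_at_imp_continuous_on has_derivative_continuous)

lemma continuous_G: "continuous_on S G"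
proof -
  have "isCont G x" for x
  proof -
    obtain L where "L-lipschitz_on (cball 0 (norm x + 1)) G" using G_lipschitz by blast
    then have "continuous_on (ball 0 (norm x + 1)) G"
      using lipschitz_on_continuous_on lipschitz_on_subset[OF _ ball_subset_cball] by blast
    then show ?thesis by (auto simp: continuous_on_eq_continuous_at)
  qed
  then show ?thesis by (simp add: continuous_at_imp_continuous_on)
qed

lemma continuous_energy: "continuous_on S energy"
proof -
  have M: "continuous_on S (\<lambda>z. M (snd z))"
    using linear_M by (intro bounded_linear.continuous_on[of M]) (auto simp: linear_conv_bounded_linear intro!: continuous_intros)
  have V: "continuous_on S (\<lambda>z. V (fst z))"
    by (rule continuous_on_compose2[OF continuous_V[of UNIV]]) (auto intro!: continuous_intros)
  show ?thesis unfolding energy_def by (intro continuous_intros M V) simp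
qed

text \<open>
  The factor \<open>v\<close> is the speed of the clock; \<open>v = - 1\<close> gives the statement for the reversed flow.
\<close>

lemma energy_derivative:
  assumes "(z has_vector_derivative v *\<^sub>R field (z t)) (at t)"
  shows "((\<lambda>t. energy (z t)) has_real_derivative - v * c * (snd (z t) \<bullet> snd (z t))) (at t)"
proof -
  let ?b = "snd (z t)"
  let ?w = "W (- c *\<^sub>R ?b - G (fst (z t)))"
  have z: "(z has_derivative (\<lambda>h. h *\<^sub>R (v *\<^sub>R field (z t)))) (at t)"
    using assms by (simp add: has_vector_derivative_def)
  have f: "((\<lambda>t. fst (z t)) has_derivative (\<lambda>h. h *\<^sub>R (v *\<^sub>R ?b))) (at t)"
    using has_derivative_fst[OF z] by (simp add: field_def)
  have s: "((\<lambda>t. snd (z t)) has_derivative (\<lambda>h. h *\<^sub>R (v *\<^sub>R ?w))) (at t)"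
    using has_derivative_snd[OF z] by (simp add: field_def)
  have lM: "bounded_linear M" using linear_M by (simp add: linear_conv_bounded_linear)
  have Ms: "((\<lambda>t. M (snd (z t))) has_derivative (\<lambda>h. h *\<^sub>R (v *\<^sub>R M ?w))) (at t)"
    using bounded_linear.has_derivative[OF lM s] by (simp add: linear_scale[OF linear_M])
  have Vf: "((\<lambda>t. V (fst (z t))) has_derivative (\<lambda>h. G (fst (z t)) \<bullet> (h *\<^sub>R (v *\<^sub>R ?b)))) (at t)"
    by (rule has_derivative_compose[OF f gradient])
  have w: "?b \<bullet> M ?w = - c * (?b \<bullet> ?b) - ?b \<bullet> G (fst (z t))" "?w \<bullet> M ?b = ?b \<bullet> M ?w"
    by (simp add: MW inner_diff_right, metis M_sym inner_commute)
  have "((\<lambda>t. energy (z t)) has_derivative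
      (\<lambda>h. (?b \<bullet> (h *\<^sub>R (v *\<^sub>R M ?w)) + (h *\<^sub>R (v *\<^sub>R ?w)) \<bullet> M ?b) / 2 + G (fst (z t)) \<bullet> (h *\<^sub>R (v *\<^sub>R ?b)))) (at t)"
    unfolding energy_def
    by (intro has_derivative_add bounded_linear.has_derivative[OF bounded_linear_divide]
        has_derivative_inner s Ms Vf)
  moreover have "(\<lambda>h. (?b \<bullet> (h *\<^sub>R (v *\<^sub>R M ?w)) + (h *\<^sub>R (v *\<^sub>R ?w)) \<bullet> M ?b) / 2 + G (fst (z t)) \<bullet> (h *\<^sub>R (v *\<^sub>R ?b)))
      = (*) (- v * c * (?b \<bullet> ?b))"
    unfolding fun_eq_iff inner_scaleR_left inner_scaleR_right w inner_commute[of "G (fst (z t))" ?b]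
    by (simp add: field_simps)
  ultimately show ?thesis by (simp add: has_field_derivative_def)
qed

lemma field_lipschitz: "\<exists>L. L-lipschitz_on (cball 0 R) field"
proof -
  obtain L where L: "L-lipschitz_on (cball 0 R) G" using G_lipschitz by blast
  have "\<exists>L. L-lipschitz_on UNIV W"
    using linear_W by (meson bounded_linear.lipschitz_boundE linear_conv_bounded_linear)
  then obtain K where K: "K-lipschitz_on UNIV W" by blast
  have L0: "L \<ge> 0" and K0: "K \<ge> 0" using L K lipschitz_on_nonneg by blast+
  have "(1 + K * (c + L))-lipschitz_on (cball 0 R) field"
  proof (rule lipschitz_onI)
    fix a b :: "'a \<times> 'a" assume ab: "a \<in> cball 0 R" "b \<in> cball 0 R"
    have f: "fst a \<in> cball 0 R" "fst b \<in> cball 0 R"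
      using ab norm_fst_le[of "fst a" "snd a"] norm_fst_le[of "fst b" "snd b"] by auto
    have d1: "dist (fst a) (fst b) \<le> dist a b" by (rule dist_fst_le)
    have d2: "dist (snd a) (snd b) \<le> dist a b" by (rule dist_snd_le)
    have "dist (- c *\<^sub>R snd a - G (fst a)) (- c *\<^sub>R snd b - G (fst b))
        \<le> dist (- c *\<^sub>R snd a) (- c *\<^sub>R snd b) + dist (G (fst a)) (G (fst b))"
      by (metis add_uminus_conv_diff dist_minus dist_triangle_add)
    also have "\<dots> \<le> c * dist a b + L * dist a b"
    proof (intro add_mono)
      show "dist (- c *\<^sub>R snd a) (- c *\<^sub>R snd b) \<le> c * dist a b"
        using d2 c_pos by (simp add: dist_norm norm_minus_commute flip: scaleR_diff_right)
      show "dist (G (fst a)) (G (fst b)) \<le> L * dist a b"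
        using lipschitz_onD[OF L f] d1 L0 by (meson mult_left_mono order_trans)
    qed
    finally have "K * dist (- c *\<^sub>R snd a - G (fst a)) (- c *\<^sub>R snd b - G (fst b)) \<le> K * ((c + L) * dist a b)"
      using K0 by (intro mult_left_mono) (auto simp: algebra_simps)
    then have "dist (snd (field a)) (snd (field b)) \<le> K * (c + L) * dist a b"
      using lipschitz_onD[OF K, of "- c *\<^sub>R snd a - G (fst a)" "- c *\<^sub>R snd b - G (fst b)"]
      by (simp add: field_def)
    moreover have "dist (fst (field a)) (fst (field b)) \<le> dist a b" using d2 by (simp add: field_def)
    moreover have "dist (field a) (field b) \<le> dist (fst (field a)) (fst (field b)) + dist (snd (field a)) (snd (field b))"
      unfolding dist_prod_def by (rule sqrt_sum_squares_le_sum) auto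
    ultimately show "dist (field a) (field b) \<le> (1 + K * (c + L)) * dist a b"
      by (simp add: algebra_simps)
  qed (use L0 K0 c_pos in auto)
  then show ?thesis by blast
qed

text \<open>
  Friction dissipates energy unless the velocity vanishes, and if it vanishes for all positive times, so
  does the force. The conclusion reaches time 0 by continuity, which makes it usable in
  \<open>lasalle_convergence\<close>.
\<close>

lemma constant_energy_imp_equilibrium:
  assumes z: "\<And>t. t \<ge> 0 \<Longrightarrow> (z has_vector_derivative v *\<^sub>R field (z t)) (at t within {0..})"
    and v: "v \<noteq> 0" and E: "\<And>t. t \<ge> 0 \<Longrightarrow> energy (z t) = e"
  shows "snd (z 0) = 0 \<and> G (fst (z 0)) = 0"
proof -
  have at_t: "(z has_vector_derivative v *\<^sub>R field (z t)) (at t)" if "t > 0" for t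
    using z[of t] that at_within_interior[of t "{0..}"] by simp
  have rest: "snd (z t) = 0" if t: "t > 0" for t
  proof -
    have "- v * c * (snd (z t) \<bullet> snd (z t)) = 0"
      by (rule DERIV_local_const[OF energy_derivative[OF at_t[OF t]] t]) (use E t in auto)
    then show ?thesis using v c_pos by simp
  qed
  have crit: "G (fst (z t)) = 0" if t: "t > 0" for t
  proof -
    have "((\<lambda>t. snd (z t)) has_vector_derivative snd (v *\<^sub>R field (z t))) (at t)"
      using at_t[OF t] by (rule bounded_linear.has_vector_derivative[OF bounded_linear_snd])
    moreover have "((\<lambda>t. snd (z t)) has_vector_derivative 0) (at t)"
      by (rule has_vector_derivative_transform_within_open[of "\<lambda>_. 0" _ _ "{0<..}"])
        (use rest t in auto)
    ultimately have "snd (v *\<^sub>R field (z t)) = 0" by (rule vector_derivative_unique_at)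
    then have "W (- G (fst (z t))) = 0" using v rest[OF t] by (simp add: field_def)
    then have "M 0 = - G (fst (z t))" using MW[of "- G (fst (z t))"] by simp
    then show ?thesis using linear_0[OF linear_M] by simp
  qed
  have "continuous_on {0..} z"
    unfolding continuous_on_eq_continuous_within using z has_vector_derivative_continuous by fastforce
  then have "z ` closure {0<..} \<subseteq> {w. snd w = 0 \<and> G (fst w) = 0}"
    using rest crit
    by (intro image_closure_subset closed_Collect_conj closed_Collect_eq)
      (auto intro!: continuous_intros continuous_on_compose2[OF continuous_G])
  then show ?thesis by auto
qed

text \<open>
  The function \<open>N\<close> describes the well as \<open>N < 1\<close>. On the rim \<open>N = 1\<close> the potential is at least \<open>V p\<close>, so an orbit
  with energy below \<open>V p\<close> that starts inside can never leave. The flow is that of the field composed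
  with the nearest-point projection onto a ball of radius \<open>R\<close>, which is globally Lipschitz; the orbits
  considered stay in this ball and solve the original equation.
\<close>

theorem heteroclinic_connection:
  fixes p :: 'a and N :: "'a \<Rightarrow> real"
  assumes contN: "continuous_on UNIV N"
    and boundedN: "bounded {x. N x \<le> 1}"
    and barrier: "\<And>x. N x = 1 \<Longrightarrow> V p \<le> V x"
    and only_origin: "\<And>x. N x \<le> 1 \<Longrightarrow> V x < V p \<Longrightarrow> G x = 0 \<Longrightarrow> x = 0"
    and G0: "G 0 = 0" and p: "p \<noteq> 0" "G p = 0"
    and isolated: "r > 0" "\<And>x. dist x p < r \<Longrightarrow> G x = 0 \<Longrightarrow> x = p"
    and approach: "\<And>e. e > 0 \<Longrightarrow> \<exists>x. dist x p < e \<and> N x < 1 \<and> V x < V p"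
  obtains z where "\<And>t. (z has_vector_derivative field (z t)) (at t)"
    "(z \<longlongrightarrow> (p, 0)) at_bot" "(z \<longlongrightarrow> 0) at_top"
proof -
  define D where "D = {z. N (fst z) \<le> 1 \<and> energy z \<le> V p}"
  have closedD: "closed {z. N (fst z) \<le> 1 \<and> energy z \<le> e}" for e
    by (intro closed_Collect_conj closed_Collect_le continuous_intros continuous_energy
        continuous_on_compose2[OF contN]) auto
  obtain R where R: "\<And>z. z \<in> D \<union> cball (p, 0) r \<Longrightarrow> z \<in> ball 0 R"
  proof -
    obtain \<rho> where \<rho>: "\<And>x. N x \<le> 1 \<Longrightarrow> norm x \<le> \<rho>"
      using boundedN unfolding bounded_iff by auto
    have "bounded (V ` cball 0 \<rho>)"
      by (intro compact_imp_bounded compact_continuous_image continuous_V compact_cball)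
    then obtain v where "\<forall>x\<in>cball 0 \<rho>. \<bar>V x\<bar> \<le> v"
      unfolding bounded_iff by auto
    then have v: "\<bar>V x\<bar> \<le> v" if "norm x \<le> \<rho>" for x using that by simp
    define b where "b = 1 + 2 * (V p + v) / m"
    have "D \<subseteq> cball 0 \<rho> \<times> cball 0 b"
    proof
      fix z assume z: "z \<in> D"
      then have f: "norm (fst z) \<le> \<rho>" and e: "energy z \<le> V p" using \<rho> by (auto simp: D_def)
      have "m * (norm (snd z))\<^sup>2 \<le> snd z \<bullet> M (snd z)"
        using M_coercive[of "snd z"] by (simp add: dot_square_norm)
      also have "\<dots> \<le> 2 * (V p + v)" using e v[OF f] by (simp add: energy_def)
      finally have "(norm (snd z))\<^sup>2 \<le> b - 1" using m_pos by (simp add: b_def field_simps)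
      \<comment> \<open>this yields \<open>2 * norm (snd z) \<le> (norm (snd z))\<^sup>2 + 1\<close>\<close>
      moreover have "0 \<le> (norm (snd z) - 1)\<^sup>2" by simp
      ultimately have "norm (snd z) \<le> b"
        unfolding power2_diff by (simp, use norm_ge_zero[of "snd z"] in linarith)
      with f show "z \<in> cball 0 \<rho> \<times> cball 0 b" by (auto simp: mem_Times_iff)
    qed
    then have "bounded (D \<union> cball (p, 0) r)"
      using bounded_subset[OF bounded_Times[OF bounded_cball bounded_cball]] by simp
    then obtain R where "\<And>z. z \<in> D \<union> cball (p, 0) r \<Longrightarrow> norm z < R"
      unfolding bounded_pos_less by blast
    then show ?thesis by (intro that) auto
  qed
  have Dball: "z \<in> ball 0 R" if "z \<in> D" for z using R that by blast
  have pball: "z \<in> ball 0 R" if "z \<in> cball (p, 0 :: 'a) r" for z using R that by blast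
  have Rpos: "R > 0" using pball[of "(p, 0)"] isolated(1) by (auto simp: intro: le_less_trans[OF norm_ge_zero])

  define f where "f z = field (closest_point (cball 0 R) z)" for z
  have f_eq: "f z = field z" if "z \<in> ball 0 R" for z
    using that by (simp add: f_def closest_point_self)
  obtain L where L: "L-lipschitz_on UNIV f"
  proof -
    obtain L where L: "L-lipschitz_on (cball 0 R) field" using field_lipschitz by blast
    have cp: "1-lipschitz_on UNIV (closest_point (cball (0 :: 'a \<times> 'a) R))"
      using Rpos by (intro lipschitz_onI) (auto intro: closest_point_lipschitz)
    have "closest_point (cball (0 :: 'a \<times> 'a) R) ` UNIV \<subseteq> cball 0 R"
      using Rpos closest_point_in_set[of "cball (0 :: 'a \<times> 'a) R"] by fastforce
    then have "(L * 1)-lipschitz_on UNIV (\<lambda>z. field (closest_point (cball 0 R) z))"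
      using lipschitz_on_compose2[OF cp] lipschitz_on_subset[OF L] by blast
    then show ?thesis using that[of "L * 1"] by (simp add: f_def[abs_def])
  qed
  obtain \<phi> where \<phi>0: "\<And>z. \<phi> 0 z = z"
    and d\<phi>: "\<And>z t. ((\<lambda>t. \<phi> t z) has_vector_derivative f (\<phi> t z)) (at t)"
    and grp: "\<And>s t z. \<phi> s (\<phi> t z) = \<phi> (s + t) z"
    and \<phi>L: "\<And>t y z. dist (\<phi> t y) (\<phi> t z) \<le> exp (L * \<bar>t\<bar>) * dist y z"
    using lipschitz_flow[OF L] by blast
  have cont\<phi>: "continuous_on S (\<phi> t)" for S t
    by (rule lipschitz_on_continuous_on[of "exp (L * \<bar>t\<bar>)"], rule lipschitz_onI) (auto intro: \<phi>L)
  have conttime: "continuous_on S (\<lambda>t. \<phi> t z)" for S z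
    using has_vector_derivative_continuous[OF d\<phi>] by (intro continuous_at_imp_continuous_on ballI)
  have dE: "((\<lambda>t. energy (\<phi> t z)) has_real_derivative - 1 * c * (snd (\<phi> t z) \<bullet> snd (\<phi> t z))) (at t)"
    if "\<phi> t z \<in> ball 0 R" for t z
    using d\<phi>[of z t] f_eq[OF that] by (intro energy_derivative) simp
  have decreasing: "energy (\<phi> t z) \<le> energy (\<phi> s z)"
    if "s \<le> t" "\<And>u. s < u \<Longrightarrow> u < t \<Longrightarrow> \<phi> u z \<in> ball 0 R" for s t z
  proof (rule DERIV_nonpos_imp_decreasing_open[OF that(1)])
    fix u assume "s < u" "u < t"
    with dE[OF that(2)] show "\<exists>y. ((\<lambda>t. energy (\<phi> t z)) has_real_derivative y) (at u) \<and> y \<le> 0"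
      using c_pos by (metis inner_ge_zero less_eq_real_def mult_minus1 mult_nonneg_nonneg mult_minus_left neg_le_0_iff_le)
  qed (rule continuous_on_compose2[OF continuous_energy[of UNIV] conttime], simp)

  have inside: "N (fst z) < 1" if "z \<in> D" "energy z < V p" for z
    using that barrier[of "fst z"] V_le_energy[of z] unfolding D_def by force
  have trapped: "\<phi> t z \<in> D \<and> energy (\<phi> t z) \<le> energy z"
    if z: "z \<in> D" "energy z < V p" and t: "t \<ge> 0" for z t
  proof -
    define U where "U = {z :: 'a \<times> 'a. N (fst z) < 1} \<inter> ball 0 R"
    have openU: "open U" unfolding U_def
      by (intro open_Int open_Collect_less continuous_intros continuous_on_compose2[OF contN]) auto
    have stay: "\<phi> s z \<in> U" if s: "s \<ge> 0" for s
    proof (rule ccontr)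
      assume "\<phi> s z \<notin> U"
      moreover have "\<phi> 0 z \<in> U" using inside[OF z] Dball[OF z(1)] by (simp add: \<phi>0 U_def)
      ultimately obtain u where u: "0 < u" "\<phi> u z \<notin> U" "\<phi> u z \<in> closure U"
        "\<And>s. 0 \<le> s \<Longrightarrow> s < u \<Longrightarrow> \<phi> s z \<in> U"
        using first_exit[OF conttime openU _ s] by metis
      have "energy (\<phi> u z) \<le> energy (\<phi> 0 z)"
        using u by (intro decreasing) (auto simp: U_def)
      then have e: "energy (\<phi> u z) < V p" using z by (simp add: \<phi>0)
      have "closure U \<subseteq> {z. N (fst z) \<le> 1}"
        by (rule closure_minimal)
          (auto simp: U_def intro!: closed_Collect_le continuous_intros continuous_on_compose2[OF contN])
      then have "\<phi> u z \<in> D" using u e by (auto simp: D_def)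
      then have "\<phi> u z \<in> U" using inside e Dball unfolding U_def by blast
      with u show False by blast
    qed
    have "energy (\<phi> t z) \<le> energy (\<phi> 0 z)"
      using t stay by (intro decreasing) (auto simp: U_def)
    then show ?thesis using stay[OF t] z by (auto simp: \<phi>0 D_def U_def)
  qed

  \<comment> \<open>the sign \<open>v\<close> selects forward or backward orbits\<close>
  have rest: "snd z = 0 \<and> G (fst z) = 0"
    if v: "v \<noteq> 0" and "\<And>s. s \<ge> 0 \<Longrightarrow> \<phi> (v * s) z \<in> ball 0 R \<and> energy (\<phi> (v * s) z) = energy z" for v z
  proof -
    have "((\<lambda>s. \<phi> (v * s) z) has_vector_derivative v *\<^sub>R field (\<phi> (v * t) z)) (at t within {0..})"
      if "t \<ge> 0" for t
    proof -
      have "(((\<lambda>s. \<phi> s z) \<circ> (\<lambda>s. v * s)) has_vector_derivative v *\<^sub>R f (\<phi> (v * t) z)) (at t)"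
        using d\<phi>[of z "v * t"]
        by (intro vector_diff_chain_at) (auto intro!: derivative_eq_intros)
      with that \<open>\<And>s. s \<ge> 0 \<Longrightarrow> \<phi> (v * s) z \<in> ball 0 R \<and> _\<close> show ?thesis
        by (auto simp: o_def f_eq intro: has_vector_derivative_at_within)
    qed
    from constant_energy_imp_equilibrium[OF _ v, of "\<lambda>s. \<phi> (v * s) z" "energy z"] this
    show ?thesis using that(2) by (simp add: \<phi>0)
  qed

  have to_origin: "((\<lambda>t. \<phi> t z) \<longlongrightarrow> 0) at_top" if z: "z \<in> D" "energy z < V p" for z
  proof (rule lasalle_convergence[of \<phi> "{w. N (fst w) \<le> 1 \<and> energy w \<le> energy z}" z energy])
    have sub: "{w. N (fst w) \<le> 1 \<and> energy w \<le> energy z} \<subseteq> D" using z by (auto simp: D_def)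
    show "compact {w. N (fst w) \<le> 1 \<and> energy w \<le> energy z}"
      using closedD sub Dball unfolding compact_eq_bounded_closed
      by (blast intro: bounded_subset[OF bounded_ball[of 0 R]])
    show "\<phi> t z \<in> {w. N (fst w) \<le> 1 \<and> energy w \<le> energy z}" if "t \<ge> 0" for t
      using trapped[OF z that] by (simp add: D_def)
    show "energy (\<phi> t z) \<le> energy (\<phi> s z)" if "0 \<le> s" "s \<le> t" for s t
      using that trapped[OF z] Dball by (intro decreasing) auto
    fix y assume y: "y \<in> {w. N (fst w) \<le> 1 \<and> energy w \<le> energy z}"
      "\<And>s. s \<ge> 0 \<Longrightarrow> \<phi> s y \<in> {w. N (fst w) \<le> 1 \<and> energy w \<le> energy z} \<and> energy (\<phi> s y) = energy y"
    have "snd y = 0 \<and> G (fst y) = 0"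
    proof (rule rest[of 1])
      fix s :: real assume "s \<ge> 0"
      with y(2) have s: "\<phi> s y \<in> {w. N (fst w) \<le> 1 \<and> energy w \<le> energy z}" "energy (\<phi> s y) = energy y"
        by blast+
      with sub Dball have "\<phi> s y \<in> ball 0 R" by blast
      with s show "\<phi> (1 * s) y \<in> ball 0 R \<and> energy (\<phi> (1 * s) y) = energy y" by simp
    qed simp
    moreover have "V (fst y) < V p" using V_le_energy[of y] y z by auto
    ultimately show "y = 0" using only_origin[of "fst y"] y by (auto simp: prod_eq_iff)
  qed (use grp cont\<phi> continuous_energy in auto)

  define \<delta> where "\<delta> = r / 2"
  have \<delta>: "\<delta> > 0" "\<delta> < r" using isolated by (auto simp: \<delta>_def)
  have far: "norm p > \<delta>" using isolated(2)[of 0] G0 p \<delta> by fastforce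
  have "\<exists>x. dist x p < \<delta> / (Suc n) \<and> N x < 1 \<and> V x < V p" for n
    using \<delta> by (intro approach) auto
  then obtain x where x: "\<And>n. dist (x n) p < \<delta> / (Suc n)" "\<And>n. N (x n) < 1" "\<And>n. V (x n) < V p"
    by metis
  have xD: "(x n, 0) \<in> D" "energy (x n, 0) < V p" for n
    using x[of n] by (auto simp: D_def energy_def)
  have dx: "dist (x n, 0 :: 'a) (p, 0) < \<delta> / (Suc n)" for n
    using x(1)[of n] by (simp add: dist_Pair_Pair)
  have "\<exists>T>0. \<phi> T (x n, 0) \<in> sphere (p, 0) \<delta> \<and> (\<forall>s. 0 \<le> s \<longrightarrow> s < T \<longrightarrow> \<phi> s (x n, 0) \<in> ball (p, 0) \<delta>)" for n
  proof -
    have "\<forall>\<^sub>F t in at_top. dist (\<phi> t (x n, 0)) 0 < norm p - \<delta>"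
      using to_origin[OF xD] far unfolding tendsto_iff by simp
    then obtain t where t: "t \<ge> 0" "norm (\<phi> t (x n, 0)) < norm p - \<delta>"
      unfolding eventually_at_top_linorder by (metis dist_0_norm dist_commute max.cobounded1 max.cobounded2)
    have "norm p = norm (p, 0 :: 'a)" by simp
    also have "\<dots> \<le> dist (p, 0) (\<phi> t (x n, 0)) + norm (\<phi> t (x n, 0))"
      by (metis dist_norm norm_minus_commute norm_triangle_sub add.commute)
    finally have "\<phi> t (x n, 0) \<notin> ball (p, 0) \<delta>" using t by auto
    moreover have "\<delta> / (Suc n) \<le> \<delta>" using \<delta> by (simp add: field_simps)
    then have "\<phi> 0 (x n, 0) \<in> ball (p, 0) \<delta>" using dx[of n] by (auto simp: \<phi>0 dist_commute)
    ultimately obtain T where T: "0 < T" "\<phi> T (x n, 0) \<notin> ball (p, 0) \<delta>" "\<phi> T (x n, 0) \<in> closure (ball (p, 0) \<delta>)"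
        "\<And>s. 0 \<le> s \<Longrightarrow> s < T \<Longrightarrow> \<phi> s (x n, 0) \<in> ball (p, 0) \<delta>"
      using first_exit[OF conttime open_ball _ t(1)] by metis
    then have "\<phi> T (x n, 0) \<in> sphere (p, 0) \<delta>" using \<delta> by auto
    then show ?thesis using T by blast
  qed
  then obtain T where T: "\<And>n. T n > 0" "\<And>n. \<phi> (T n) (x n, 0) \<in> sphere (p, 0) \<delta>"
    "\<And>n s. 0 \<le> s \<Longrightarrow> s < T n \<Longrightarrow> \<phi> s (x n, 0) \<in> ball (p, 0) \<delta>"
    by metis

  have fixp: "\<phi> t (p, 0) = (p, 0)" for t
  proof -
    have "f (p, 0) = 0" using pball[of "(p, 0)"] isolated p linear_0[OF linear_W]
      by (simp add: f_eq field_def zero_prod_def)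
    then have "((\<lambda>_. (p, 0)) has_vector_derivative f (p, 0)) (at t)" for t by simp
    from lipschitz_ode_dist[OF L d\<phi>[of "(p, 0)"] this, of t] show ?thesis by (simp add: \<phi>0)
  qed
  \<comment> \<open>a solution that starts close to the rest state \<open>(p, 0)\<close> needs a long time to leave the ball\<close>
  have Tlarge: "s < T n" if "exp (L * s) < Suc n" "s \<ge> 0" for s n
  proof (rule ccontr)
    assume Ts: "\<not> s < T n"
    have L0: "L \<ge> 0" using L by (rule lipschitz_on_nonneg)
    have "\<delta> = dist (\<phi> (T n) (x n, 0)) (\<phi> (T n) (p, 0))"
      using T(2)[of n] by (simp add: fixp dist_commute)
    also have "\<dots> \<le> exp (L * T n) * dist (x n, 0 :: 'a) (p, 0)"
      using \<phi>L[of "T n" "(x n, 0)" "(p, 0)"] T(1)[of n] by simp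
    also have "\<dots> < exp (L * T n) * (\<delta> / Suc n)" by (rule mult_strict_left_mono[OF dx]) simp
    also have "\<dots> \<le> exp (L * s) * (\<delta> / Suc n)"
      using Ts \<delta> L0 by (intro mult_right_mono) (auto intro: mult_left_mono)
    finally have "real (Suc n) * \<delta> < exp (L * s) * \<delta>" by (simp add: field_simps)
    then show False using that \<delta> by simp
  qed

  have "compact (sphere (p, 0 :: 'a) \<delta> \<inter> D)"
    using closedD[of "V p"] by (intro compact_Int_closed) (auto simp: D_def)
  moreover have "\<phi> (T n) (x n, 0) \<in> sphere (p, 0) \<delta> \<inter> D" for n
    using T(2) trapped[OF xD] T(1)[of n] by (simp add: less_imp_le)
  ultimately obtain y k where y: "y \<in> sphere (p, 0) \<delta> \<inter> D" and k: "strict_mono (k :: nat \<Rightarrow> nat)"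
    and lim: "((\<lambda>n. \<phi> (T n) (x n, 0)) \<circ> k) \<longlonglongrightarrow> y"
    using compact_def[THEN iffD1, THEN spec, of "sphere (p, 0) \<delta> \<inter> D" "\<lambda>n. \<phi> (T n) (x n, 0)"]
    by blast
  \<comment> \<open>the \<open>n\<close>-th orbit is in the ball during the time \<open>T n\<close> before its exit; pass to the limit\<close>
  have backward: "\<phi> (- s) y \<in> cball (p, 0) \<delta> \<inter> D" if s: "s \<ge> 0" for s
  proof (rule Lim_in_closed_set)
    show "closed (cball (p, 0) \<delta> \<inter> D)" using closedD[of "V p"] by (auto simp: D_def)
    have "(\<lambda>n. \<phi> (- s) (((\<lambda>n. \<phi> (T n) (x n, 0)) \<circ> k) n)) \<longlonglongrightarrow> \<phi> (- s) y"
      by (rule continuous_on_tendsto_compose[OF cont\<phi>[of UNIV] lim]) auto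
    then show "(\<lambda>n. \<phi> (- s + T (k n)) (x (k n), 0)) \<longlonglongrightarrow> \<phi> (- s) y"
      by (simp add: grp)
    obtain n0 :: nat where n0: "exp (L * s) < real n0" using reals_Archimedean2 by blast
    have "\<phi> (- s + T (k n)) (x (k n), 0) \<in> cball (p, 0) \<delta> \<inter> D" if "n \<ge> n0" for n
    proof -
      have "n0 \<le> k n" using that seq_suble[OF k, of n] by linarith
      then have "s < T (k n)" using n0 s by (intro Tlarge) auto
      then show ?thesis
        using T(3)[of "- s + T (k n)" "k n"] trapped[OF xD, of "- s + T (k n)" "k n"] s
        by (cases "s = 0") (use T(2)[of "k n"] in \<open>auto simp: less_imp_le\<close>)
    qed
    then show "\<forall>\<^sub>F n in sequentially. \<phi> (- s + T (k n)) (x (k n), 0) \<in> cball (p, 0) \<delta> \<inter> D"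
      unfolding eventually_sequentially by blast
  qed simp
  have backR: "\<phi> s y \<in> ball 0 R" if "s \<le> 0" for s
    using backward[of "- s"] Dball[of "\<phi> s y"] that by simp
  have near_rest: "w = (p, 0)" if "w \<in> cball (p, 0 :: 'a) \<delta>" "snd w = 0 \<and> G (fst w) = 0" for w
  proof -
    have "dist (fst w) p \<le> \<delta>"
      using that(1) dist_fst_le[of w "(p, 0)"] by (simp add: dist_commute)
    then show ?thesis using isolated(2)[of "fst w"] \<delta> that(2) by (simp add: prod_eq_iff)
  qed
  \<comment> \<open>otherwise the backward orbit of \<open>y\<close> has constant energy, so \<open>y\<close> is at rest and equals \<open>(p, 0)\<close>\<close>
  have ylow: "energy y < V p"
  proof (rule ccontr)
    assume "\<not> ?thesis"
    moreover have "energy y \<le> energy (\<phi> (- s) y) \<and> energy (\<phi> (- s) y) \<le> V p" if "s \<ge> 0" for s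
      using decreasing[of "- s" 0 y] backR backward[OF that] that by (auto simp: \<phi>0 D_def)
    ultimately have "\<phi> (- 1 * s) y \<in> ball 0 R \<and> energy (\<phi> (- 1 * s) y) = energy y" if "s \<ge> 0" for s
      using that backR[of "- s"] by fastforce
    then have "snd y = 0 \<and> G (fst y) = 0" by (intro rest[of "- 1"]) auto
    then have "y = (p, 0)" using y by (intro near_rest) auto
    with y \<delta> show False by simp
  qed
  have yD: "y \<in> D" using y by simp
  show ?thesis
  proof (rule that)
    show "((\<lambda>t. \<phi> t y) has_vector_derivative field (\<phi> t y)) (at t)" for t
    proof -
      have "\<phi> t y \<in> ball 0 R"
        using backR[of t] trapped[OF yD ylow, of t] Dball by (cases "t \<le> 0") auto
      then show ?thesis using d\<phi>[of y t] by (simp add: f_eq)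
    qed
    show "((\<lambda>t. \<phi> t y) \<longlongrightarrow> 0) at_top" by (rule to_origin[OF yD ylow])
    have "((\<lambda>t. \<phi> (- t) y) \<longlongrightarrow> (p, 0)) at_top"
    proof (rule lasalle_convergence[of "\<lambda>t. \<phi> (- t)" "cball (p, 0) \<delta>" y "\<lambda>w. - energy w"])
      show "- energy (\<phi> (- t) y) \<le> - energy (\<phi> (- s) y)" if "0 \<le> s" "s \<le> t" for s t
        using that backR by (auto intro!: decreasing)
      fix w assume w: "w \<in> cball (p, 0) \<delta>"
        "\<And>s. 0 \<le> s \<Longrightarrow> \<phi> (- s) w \<in> cball (p, 0) \<delta> \<and> - energy (\<phi> (- s) w) = - energy w"
      have "snd w = 0 \<and> G (fst w) = 0"
      proof (rule rest[of "- 1"])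
        fix s :: real assume "s \<ge> 0"
        with w(2) have s: "\<phi> (- s) w \<in> cball (p, 0) \<delta>" "energy (\<phi> (- s) w) = energy w" by auto
        have "\<phi> (- s) w \<in> ball 0 R" by (rule pball) (use s \<delta> in auto)
        with s show "\<phi> (- 1 * s) w \<in> ball 0 R \<and> energy (\<phi> (- 1 * s) w) = energy w" by simp
      qed simp
      with w show "w = (p, 0)" by (intro near_rest)
    qed (use backward cont\<phi> in \<open>auto simp: grp intro!: continuous_intros continuous_energy\<close>)
    then show "((\<lambda>t. \<phi> t y) \<longlongrightarrow> (p, 0)) at_bot"
      by (simp add: filterlim_at_bot_mirror)
  qed
qed

end

section \<open>Potentials with terms of degrees two, three and four\<close>

text \<open>
  The hypothesis on \<open>a + 3 * b - d\<close> says that the quartic has a critical point at \<open>s = 1\<close>. After elimination of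
  \<open>b\<close> the difference of the two sides is \<open>(1 - s)\<^sup>2\<close> times a polynomial with nonnegative coefficients.
\<close>

lemma quartic_below_critical_value:
  fixes a b d s :: real
  assumes "a \<ge> 0" "d \<ge> 0" "a + 3 * b - d = 0" "s \<ge> 0"
  shows "a / 2 * s^2 + b * s^3 - d / 4 * s^4 \<le> a / 2 + b - d / 4"
    and "a > 0 \<Longrightarrow> s \<noteq> 1 \<Longrightarrow> a / 2 * s^2 + b * s^3 - d / 4 * s^4 < a / 2 + b - d / 4"
proof -
  have b: "b = (d - a) / 3" using assms by simp
  have eq: "a / 2 + b - d / 4 - (a / 2 * s^2 + b * s^3 - d / 4 * s^4)
      = a * ((1 - s)^2 * (1 + 2 * s) / 6) + d * ((1 - s)^2 * (1 + 2 * s + 3 * s^2) / 12)"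
    unfolding b by (simp add: field_simps power2_eq_square power3_eq_cube power4_eq_xxxx)
  have "0 \<le> a * ((1 - s)^2 * (1 + 2 * s) / 6) + d * ((1 - s)^2 * (1 + 2 * s + 3 * s^2) / 12)"
    using assms by simp
  then show "a / 2 * s^2 + b * s^3 - d / 4 * s^4 \<le> a / 2 + b - d / 4"
    using eq by linarith
  assume "a > 0" "s \<noteq> 1"
  then have "0 < a * ((1 - s)^2 * (1 + 2 * s) / 6) + d * ((1 - s)^2 * (1 + 2 * s + 3 * s^2) / 12)"
    using assms by (intro add_pos_nonneg mult_pos_pos divide_pos_pos) auto
  then show "a / 2 * s^2 + b * s^3 - d / 4 * s^4 < a / 2 + b - d / 4"
    using eq by linarith
qed

context damped_gradient_system
begin

text \<open>
  Every ray meets the surface \<open>N = 1\<close>, because \<open>N\<close> is homogeneous and positive; as a critical point is the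
  maximum of \<open>V\<close> on its ray, all of them except the origin have level at least \<open>V p\<close>. The points
  \<open>(1 - q) *\<^sub>R p\<close> with small \<open>q > 0\<close> lie inside the well and strictly below \<open>p\<close>.
\<close>

theorem quartic_heteroclinic_connection:
  fixes p :: 'a and N a b d :: "'a \<Rightarrow> real"
  assumes ray: "\<And>s x. V (s *\<^sub>R x) = a x / 2 * s^2 + b x * s^3 - d x / 4 * s^4"
    and a_pos: "\<And>x. x \<noteq> 0 \<Longrightarrow> a x > 0" and d_nonneg: "\<And>x. d x \<ge> 0"
    and contN: "continuous_on UNIV N"
    and N_hom: "\<And>s x. N (s *\<^sub>R x) = s^2 * N x"
    and N_coercive: "n > 0" "\<And>x. n * (x \<bullet> x) \<le> N x"
    and barrier: "\<And>x. N x = 1 \<Longrightarrow> V p \<le> V x"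
    and p: "G p = 0" "N p = 1"
    and isolated: "r > 0" "\<And>x. dist x p < r \<Longrightarrow> G x = 0 \<Longrightarrow> x = p"
  obtains z where "\<And>t. (z has_vector_derivative field (z t)) (at t)"
    "(z \<longlongrightarrow> (p, 0)) at_bot" "(z \<longlongrightarrow> 0) at_top"
proof -
  have radial: "(\<lambda>h. G (s *\<^sub>R x) \<bullet> (h *\<^sub>R x)) = (*) (a x * s + 3 * b x * s^2 - d x * s^3)" for s x
  proof -
    have "((\<lambda>s. s *\<^sub>R x) has_derivative (\<lambda>h. h *\<^sub>R x)) (at s)"
      by (auto intro!: derivative_eq_intros)
    from has_derivative_compose[OF this gradient[of "s *\<^sub>R x"]]
    have 1: "((\<lambda>s. V (s *\<^sub>R x)) has_derivative (\<lambda>h. G (s *\<^sub>R x) \<bullet> (h *\<^sub>R x))) (at s)" .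
    have "((\<lambda>s. V (s *\<^sub>R x)) has_real_derivative a x * s + 3 * b x * s^2 - d x * s^3) (at s)"
      unfolding ray by (auto intro!: derivative_eq_intros)
    then show ?thesis
      using has_derivative_unique[OF 1] unfolding has_field_derivative_def by blast
  qed
  \<comment> \<open>the radial derivative of \<open>V\<close> at \<open>x\<close>, read off from the expansion on the ray\<close>
  have euler: "G x \<bullet> x = a x + 3 * b x - d x" for x
    using fun_cong[OF radial[of 1 x], of 1] by simp
  have "G 0 \<bullet> G 0 = 0" using fun_cong[OF radial[of 0 "G 0"], of 1] by simp
  then have G0: "G 0 = 0" by simp
  have Vx: "V x = a x / 2 + b x - d x / 4" for x using ray[of 1 x] by simp
  have pos: "0 < N x" if "x \<noteq> 0" for x
  proof -
    have "0 < n * (x \<bullet> x)" using that N_coercive by simp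
    with N_coercive(2)[of x] show ?thesis by linarith
  qed
  have p0: "p \<noteq> 0" using p(2) N_hom[of 0 0] by auto
  show ?thesis
  proof (rule heteroclinic_connection[OF contN _ barrier _ G0 p0 p(1) isolated])
    have "norm x \<le> 1 + 1 / n" if "N x \<le> 1" for x
    proof -
      have "n * (norm x)^2 \<le> 1" using that N_coercive(2)[of x] by (simp add: dot_square_norm)
      then have "(norm x)^2 \<le> 1 / n" using N_coercive by (simp add: field_simps)
      moreover have "0 \<le> (norm x - 1)^2" by simp
      ultimately show ?thesis unfolding power2_diff by (simp, use norm_ge_zero[of x] in linarith)
    qed
    then show "bounded {x. N x \<le> 1}" unfolding bounded_iff by blast
  next
    fix x assume x: "V x < V p" "G x = 0"
    show "x = 0"
    proof (rule ccontr)
      assume "x \<noteq> 0"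
      define s where "s = 1 / sqrt (N x)"
      have "N (s *\<^sub>R x) = 1" using pos[OF \<open>x \<noteq> 0\<close>] by (simp add: N_hom s_def power_divide)
      then have "V p \<le> V (s *\<^sub>R x)" by (rule barrier)
      also have "\<dots> \<le> V x"
        unfolding ray Vx[of x]
        using euler[of x] x(2) a_pos[OF \<open>x \<noteq> 0\<close>] d_nonneg[of x] pos[OF \<open>x \<noteq> 0\<close>]
        by (intro quartic_below_critical_value(1)) (auto simp: s_def)
      finally show False using x by simp
    qed
  next
    fix e :: real assume e: "e > 0"
    define q where "q = min (1 / 2) (e / (2 * norm p))"
    have q: "0 < q" "q < 1" "q \<le> e / (2 * norm p)" using e p0 by (auto simp: q_def)
    have "(1 - q) *\<^sub>R p - p = (- q) *\<^sub>R p" by (simp add: algebra_simps)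
    then have "dist ((1 - q) *\<^sub>R p) p = q * norm p" using q by (simp add: dist_norm)
    also have "\<dots> \<le> e / 2" using q p0 by (simp add: field_simps)
    also have "\<dots> < e" using e by simp
    finally have near: "dist ((1 - q) *\<^sub>R p) p < e" .
    have "(1 - q)^2 < 1" using q by (simp add: power_less_one_iff)
    then have "N ((1 - q) *\<^sub>R p) < 1" using p by (simp add: N_hom)
    moreover have "V ((1 - q) *\<^sub>R p) < V p"
      unfolding ray Vx[of p]
      using euler[of p] p a_pos[OF p0] d_nonneg[of p] q
      by (intro quartic_below_critical_value(2)) auto
    ultimately show "\<exists>x. dist x p < e \<and> N x < 1 \<and> V x < V p" using near by blast
  qed (blast intro: that)+
qed

end

section \<open>Surfaces on which the potential stays above the hexagon level\<close>

text \<open>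
  Units are chosen such that \<open>K0 = - 1\<close> and the hexagon is \<open>(1, 1, 1)\<close> up to signs; then \<open>K2 = 1 - r\<^sup>2 / 2\<close> and
  \<open>\<mu>0 = r\<^sup>2 - 1 + b\<close>, the cubic term has its worst sign, and the left-hand side is the hexagon level.

  The difference of the two sides is affine in \<open>b\<close>. Its slope is nonnegative on the surface
  (the fact \<open>first\<close>), so only \<open>b = (2 - r) * (1 + r)\<close> matters. For this value, and with \<open>x\<close> and
  \<open>u = (y\<^sup>2 + z\<^sup>2) / 2\<close> kept fixed, the right-hand side decreases in \<open>t = y * z\<close>, whose
  maximum \<open>t = u\<close> is the case \<open>y = z\<close>. There the difference equals
  \<open>(2 - r) * (1 + r) / 2 * u * (x - 1)\<^sup>2\<close>.
\<close>

lemma hexagon_barrier_ordered: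
  fixes r b x y z :: real
  assumes r: "0 < r" "r \<le> 2" and b: "b \<ge> (2 - r) * (1 + r)"
    and x: "0 \<le> y" "0 \<le> z" "y \<le> x" "z \<le> x"
    and surf: "x^2 + r / 2 * (y^2 + z^2) = 1 + r"
  shows "3 * (r^2 - 1) / 4 + b / 2 \<le>
    (r^2 - 1 + b) / 2 * (x^2 + y^2 + z^2) - b * (x * y * z)
    - ((x^2 + y^2 + z^2)^2 - (4 - r^2) * (x^2 * y^2 + x^2 * z^2 + y^2 * z^2)) / 4"
proof -
  define u where "u = (y^2 + z^2) / 2"
  have yz: "y * z \<le> u" "0 \<le> y * z" "0 \<le> u"
    using sum_squares_bound[of y z] x by (auto simp: u_def)
  have xu: "x^2 = 1 + r - r * u" using surf by (simp add: u_def field_simps)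
  have x0: "0 \<le> x" using x by simp
  have "y^2 \<le> x^2" "z^2 \<le> x^2" using x by (auto intro: power_mono)
  then have "u \<le> x^2" by (simp add: u_def)
  then have "(1 + r) * u \<le> (1 + r) * 1" using xu by (simp add: algebra_simps)
  then have u1: "u \<le> 1" using r by (subst (asm) mult_le_cancel_left_pos) auto
  then have "r * u \<le> r * 1" using r by (intro mult_left_mono) auto
  then have "1 \<le> x^2" using xu by simp
  then have x1: "1 \<le> x" using x0 power2_le_imp_le[of 1 x] by simp
  have S: "x^2 + y^2 + z^2 = x^2 + 2 * u" by (simp add: u_def)
  \<comment> \<open>the slope in \<open>b\<close>, for \<open>y = z\<close>, is a multiple of \<open>(x - 1)\<^sup>2\<close>\<close>
  have "0 \<le> (x - 1)^2 * (r + 2 * (x + 1))" using x1 r by simp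
  also have "\<dots> = r * (x^2 - 1 + 2 * u - 2 * (x * u))"
  proof -
    have "r * u = 1 + r - x^2" using xu by simp
    have "r * (x^2 - 1 + 2 * u - 2 * (x * u)) = r * (x^2 - 1) + 2 * (1 - x) * (r * u)"
      by (simp add: algebra_simps)
    also have "r * u = 1 + r - x^2" by fact
    also have "r * (x^2 - 1) + 2 * (1 - x) * (1 + r - x^2) = (x - 1)^2 * (r + 2 * (x + 1))"
      by (simp add: power2_eq_square algebra_simps)
    finally show ?thesis by simp
  qed
  finally have "2 * (x * u) \<le> x^2 - 1 + 2 * u" using r by (simp add: zero_le_mult_iff)
  moreover have "x * (y * z) \<le> x * u" using yz x0 by (intro mult_left_mono)
  ultimately have "2 * (x * (y * z)) \<le> x^2 - 1 + 2 * u" by linarith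
  then have first: "0 \<le> (x^2 + y^2 + z^2) / 2 - x * y * z - 1 / 2"
    unfolding S by (simp add: mult.assoc diff_divide_distrib add_divide_distrib)
  define t where "t = y * z"
  have tu: "t \<le> u" "u + t \<le> 2" using yz u1 by (auto simp: t_def)
  have "0 \<le> 2 * (1 + r) * u * (x - 1)^2" using r yz by simp
  also have "\<dots> = - (2 - r) * u^2 + (2 + r) * (2 * x^2 * u + u^2) - 4 * (1 + r) * x * u"
  proof -
    have "r * u^2 = (r * u) * u" by (simp add: power2_eq_square)
    also have "r * u = 1 + r - x^2" using xu by simp
    finally have "r * u^2 = (1 + r - x^2) * u" .
    moreover have "- (2 - r) * u^2 + (2 + r) * (2 * x^2 * u + u^2) - 4 * (1 + r) * x * u
        = 2 * (r * u^2) + 2 * (2 + r) * x^2 * u - 4 * (1 + r) * x * u"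
      by (simp add: algebra_simps)
    ultimately show ?thesis by (simp add: power2_eq_square algebra_simps)
  qed
  also have "\<dots> \<le> - (2 - r) * u^2 + (2 + r) * (2 * x^2 * u + t^2) - 4 * (1 + r) * x * t"
  proof -
    have "(2 + r) * (u + t) \<le> (2 + r) * 2" using tu r by (intro mult_left_mono) auto
    also have "\<dots> \<le> 4 * (1 + r) * 1" using r by simp
    also have "\<dots> \<le> 4 * (1 + r) * x" using r x1 by (intro mult_left_mono) auto
    finally have "0 \<le> (u - t) * (4 * (1 + r) * x - (2 + r) * (u + t))" using tu by simp
    then show ?thesis by (simp add: power2_eq_square algebra_simps)
  qed
  finally have "0 \<le> (2 - r) / 4 * (- (2 - r) * u^2 + (2 + r) * (2 * x^2 * u + t^2) - 4 * (1 + r) * x * t)"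
    using r by (intro mult_nonneg_nonneg) auto
  also have "\<dots> = - (((2 - r) * u)^2 / 4) + (2 - r) * ((2 + r) * (2 * x^2 * u + t^2) / 4 - (1 + r) * x * t)"
    by (simp add: field_simps power2_eq_square)
  also have "(2 - r) * u = x^2 + y^2 + z^2 - (1 + r)" using xu S by (simp add: algebra_simps)
  also have "2 * x^2 * u + t^2 = x^2 * y^2 + x^2 * z^2 + y^2 * z^2"
    by (simp add: u_def t_def algebra_simps power_mult_distrib)
  finally have second: "0 \<le> - ((x^2 + y^2 + z^2 - (1 + r))^2 / 4)
      + (2 - r) * ((2 + r) * (x^2 * y^2 + x^2 * z^2 + y^2 * z^2) / 4 - (1 + r) * x * t)" .
  have third: "0 \<le> (b - (2 - r) * (1 + r)) * ((x^2 + y^2 + z^2) / 2 - x * y * z - 1 / 2)"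
    using first b by simp
  have key: "- ((S - (1 + r))^2 / 4) + (2 - r) * ((2 + r) * E / 4 - (1 + r) * P)
        + (b - (2 - r) * (1 + r)) * (S / 2 - P - 1 / 2)
      = (r^2 - 1 + b) / 2 * S - b * P - (S^2 - (4 - r^2) * E) / 4 - (3 * (r^2 - 1) / 4 + b / 2)" for S E P :: real
    by (simp add: field_simps power2_eq_square)
  have "(1 + r) * x * t = (1 + r) * (x * y * z)" by (simp add: t_def)
  from add_nonneg_nonneg[OF second[unfolded this] third] show ?thesis
    by (simp only: key diff_ge_0_iff_ge)
qed

text \<open>
  The surface is the same for all orderings and signs of the components: by symmetry the largest
  square can be moved to the first place, and \<open>b * (x * y * z)\<close> is at least its value with the worst sign.
\<close>

lemma hexagon_barrier_weighted:
  fixes r b x y z :: real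
  assumes r: "0 < r" "r \<le> 2" and b: "b \<ge> (2 - r) * (1 + r)"
    and surf: "r / 2 * (x^2 + y^2 + z^2) + (1 - r / 2) * max (x^2) (max (y^2) (z^2)) = 1 + r"
  shows "3 * (r^2 - 1) / 4 + b / 2 \<le>
    (r^2 - 1 + b) / 2 * (x^2 + y^2 + z^2) + b * (x * y * z)
    - ((x^2 + y^2 + z^2)^2 - (4 - r^2) * (x^2 * y^2 + x^2 * z^2 + y^2 * z^2)) / 4"
proof -
  have "0 \<le> (2 - r) * (1 + r)" using r by simp
  then have b0: "0 \<le> b" using b by linarith
  have main: "3 * (r^2 - 1) / 4 + b / 2 \<le>
      (r^2 - 1 + b) / 2 * (x^2 + y^2 + z^2) + b * (x * y * z)
      - ((x^2 + y^2 + z^2)^2 - (4 - r^2) * (x^2 * y^2 + x^2 * z^2 + y^2 * z^2)) / 4"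
    if le: "y^2 \<le> x^2" "z^2 \<le> x^2"
      and "r / 2 * (x^2 + y^2 + z^2) + (1 - r / 2) * x^2 = 1 + r" for x y z :: real
  proof -
    have "x^2 + r / 2 * (y^2 + z^2) = 1 + r" using that(3) by (simp add: field_simps)
    then have "3 * (r^2 - 1) / 4 + b / 2 \<le>
      (r^2 - 1 + b) / 2 * (x^2 + y^2 + z^2) - b * (\<bar>x\<bar> * \<bar>y\<bar> * \<bar>z\<bar>)
      - ((x^2 + y^2 + z^2)^2 - (4 - r^2) * (x^2 * y^2 + x^2 * z^2 + y^2 * z^2)) / 4"
      using hexagon_barrier_ordered[OF r b, of "\<bar>y\<bar>" "\<bar>z\<bar>" "\<bar>x\<bar>"] le by (simp add: abs_le_square_iff)
    moreover have "b * (- (x * y * z)) \<le> b * (\<bar>x\<bar> * \<bar>y\<bar> * \<bar>z\<bar>)"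
      using b0 by (intro mult_left_mono) (metis abs_ge_minus_self abs_mult)
    ultimately show ?thesis by linarith
  qed
  consider "y^2 \<le> x^2" "z^2 \<le> x^2" | "x^2 \<le> y^2" "z^2 \<le> y^2" | "x^2 \<le> z^2" "y^2 \<le> z^2"
    by linarith
  then show ?thesis
  proof cases
    case 1
    then show ?thesis using surf by (intro main) (auto simp: max_absorb1)
  next
    case 2
    have "3 * (r^2 - 1) / 4 + b / 2 \<le>
      (r^2 - 1 + b) / 2 * (y^2 + x^2 + z^2) + b * (y * x * z)
      - ((y^2 + x^2 + z^2)^2 - (4 - r^2) * (y^2 * x^2 + y^2 * z^2 + x^2 * z^2)) / 4"
      using 2 surf by (intro main) (auto simp: max_absorb1 max_absorb2 ac_simps)
    then show ?thesis by (simp only: ac_simps)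
  next
    case 3
    have "3 * (r^2 - 1) / 4 + b / 2 \<le>
      (r^2 - 1 + b) / 2 * (z^2 + x^2 + y^2) + b * (z * x * y)
      - ((z^2 + x^2 + y^2)^2 - (4 - r^2) * (z^2 * x^2 + z^2 * y^2 + x^2 * y^2)) / 4"
      using 3 surf by (intro main) (auto simp: max_absorb1 max_absorb2 ac_simps)
    then show ?thesis by (simp only: ac_simps)
  qed
qed

text \<open>
  On a sphere the quartic term depends only on \<open>e = x\<^sup>2 * y\<^sup>2 + x\<^sup>2 * z\<^sup>2 + y\<^sup>2 * z\<^sup>2\<close> and decreases in \<open>e\<close>. By the inequalities
  \<open>3 * e \<le> S\<^sup>2\<close> and \<open>3 * S * (x * y * z)\<^sup>2 \<le> e\<^sup>2\<close>, where \<open>S = x\<^sup>2 + y\<^sup>2 + z\<^sup>2\<close>, both \<open>e\<close> and the modulus of the product are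
  largest when all squares agree.
\<close>

lemma hexagon_barrier_sphere:
  fixes h x y z k0 k2 \<mu> \<beta> :: real
  assumes h: "h > 0" and k: "k2 \<le> k0" and "\<beta> \<ge> 0" and S: "x^2 + y^2 + z^2 = 3 * h^2"
  shows "\<mu> / 2 * (3 * h^2) - \<beta> * h^3 + 3 / 4 * (k0 + 2 * k2) * h^4 \<le>
    \<mu> / 2 * (x^2 + y^2 + z^2) + \<beta> * (x * y * z) + k0 / 4 * (x^4 + y^4 + z^4)
      + k2 / 2 * (x^2 * y^2 + x^2 * z^2 + y^2 * z^2)"
proof -
  define e where "e = x^2 * y^2 + x^2 * z^2 + y^2 * z^2"
  have S2: "x^4 + y^4 + z^4 = (x^2 + y^2 + z^2)^2 - 2 * e"
    by (simp add: e_def power2_eq_square power4_eq_xxxx algebra_simps)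
  have "0 \<le> (x^2 - y^2)^2 + (x^2 - z^2)^2 + (y^2 - z^2)^2" by simp
  also have "\<dots> = 2 * (x^2 + y^2 + z^2)^2 - 6 * e"
    by (simp add: e_def power2_eq_square algebra_simps)
  finally have e: "e \<le> 3 * h^4" unfolding S by (simp add: power2_eq_square power4_eq_xxxx)
  have "0 \<le> (x^2 * y^2 - x^2 * z^2)^2 + (x^2 * y^2 - y^2 * z^2)^2 + (x^2 * z^2 - y^2 * z^2)^2" by simp
  also have "\<dots> = 2 * e^2 - 6 * ((x^2 + y^2 + z^2) * (x * y * z)^2)"
    by (simp add: e_def power2_eq_square algebra_simps)
  finally have "9 * h^2 * (x * y * z)^2 \<le> e^2" unfolding S by simp
  also have "e^2 \<le> (3 * h^4)^2" using e by (intro power_mono) (auto simp: e_def)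
  also have "(3 * h^4)^2 = 9 * h^2 * (h^3)^2" by (simp add: power_mult_distrib flip: power_add power_mult)
  finally have "(x * y * z)^2 \<le> (h^3)^2" using h by (subst (asm) mult_le_cancel_left_pos) auto
  then have "\<bar>x * y * z\<bar> \<le> \<bar>h^3\<bar>" by (simp only: abs_le_square_iff)
  then have "\<bar>x * y * z\<bar> \<le> h^3" using h by simp
  then have "\<beta> * (- (h^3)) \<le> \<beta> * (x * y * z)" using \<open>\<beta> \<ge> 0\<close> by (intro mult_left_mono) auto
  moreover have "(k0 - k2) / 2 * e \<le> (k0 - k2) / 2 * (3 * h^4)" using e k by (intro mult_left_mono) auto
  moreover have "(3 * h^2)^2 = 9 * h^4" by (simp add: power_mult_distrib flip: power_mult)
  ultimately show ?thesis unfolding S2 S e_def[symmetric] by (simp add: field_simps)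
qed

section \<open>System (T) as a damped gradient system\<close>

lemma lipschitz_on_bounded_mult:
  fixes f g :: "'a::heine_borel \<Rightarrow> real"
  assumes S: "bounded S" and "\<exists>L. L-lipschitz_on S f" "\<exists>L. L-lipschitz_on S g"
  shows "\<exists>L. L-lipschitz_on S (\<lambda>x. f x * g x)"
proof -
  obtain L K where L: "L-lipschitz_on S f" and K: "K-lipschitz_on S g" using assms by blast
  have bnd: "\<exists>B\<ge>0. \<forall>x\<in>S. \<bar>h x\<bar> \<le> B" if "C-lipschitz_on S h" for h :: "'a \<Rightarrow> real" and C
  proof -
    have "uniformly_continuous_on S h" using that by (rule lipschitz_on_uniformly_continuous)
    then have "bounded (h ` S)" using S by (rule bounded_uniformly_continuous_image)
    then obtain B where "\<forall>y\<in>h ` S. norm y \<le> B" unfolding bounded_iff by blast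
    then show ?thesis by (intro exI[of _ "max 0 B"]) auto
  qed
  obtain B C where B: "B \<ge> 0" "\<forall>x\<in>S. \<bar>f x\<bar> \<le> B" and C: "C \<ge> 0" "\<forall>x\<in>S. \<bar>g x\<bar> \<le> C"
    using bnd[OF L] bnd[OF K] by blast
  have "(B * K + L * C)-lipschitz_on S (\<lambda>x. f x * g x)"
  proof (rule lipschitz_onI)
    show "0 \<le> B * K + L * C" using B C lipschitz_on_nonneg[OF L] lipschitz_on_nonneg[OF K] by simp
    fix x y assume xy: "x \<in> S" "y \<in> S"
    have "f x * g x - f y * g y = f x * (g x - g y) + (f x - f y) * g y" by (simp add: algebra_simps)
    then have "dist (f x * g x) (f y * g y) \<le> \<bar>f x\<bar> * dist (g x) (g y) + dist (f x) (f y) * \<bar>g y\<bar>"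
      unfolding dist_real_def by (metis abs_mult abs_triangle_ineq)
    also have "\<dots> \<le> B * (K * dist x y) + (L * dist x y) * C"
      using B C xy lipschitz_onD[OF L xy] lipschitz_onD[OF K xy] lipschitz_on_nonneg[OF L]
      by (intro add_mono mult_mono) auto
    finally show "dist (f x * g x) (f y * g y) \<le> (B * K + L * C) * dist x y"
      by (simp add: algebra_simps)
  qed
  then show ?thesis by blast
qed

lemma lipschitz_on_ex_add:
  fixes f g :: "'a::metric_space \<Rightarrow> real"
  assumes "\<exists>L. L-lipschitz_on S f" "\<exists>L. L-lipschitz_on S g"
  shows "\<exists>L. L-lipschitz_on S (\<lambda>x. f x + g x)"
  using assms lipschitz_on_add by blast

lemma lipschitz_on_ex_const: "\<exists>L. L-lipschitz_on S (\<lambda>_. c)"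
  by (intro exI[of _ 0] lipschitz_on_constant)

lemma lipschitz_on_ex_power:
  fixes f :: "'a::heine_borel \<Rightarrow> real"
  assumes "bounded S" "\<exists>L. L-lipschitz_on S f"
  shows "\<exists>L. L-lipschitz_on S (\<lambda>x. f x ^ n)"
  by (induction n) (auto intro!: lipschitz_on_ex_const lipschitz_on_bounded_mult assms)

lemma lipschitz_on_ex_vec:
  fixes f :: "'a::metric_space \<Rightarrow> real ^ 'n"
  assumes "\<And>j. \<exists>L. L-lipschitz_on S (\<lambda>x. f x $ j)"
  shows "\<exists>L. L-lipschitz_on S f"
proof -
  obtain L where L: "\<And>j. (L j)-lipschitz_on S (\<lambda>x. f x $ j)" using assms by metis
  have "(\<Sum>j\<in>UNIV. L j)-lipschitz_on S f"
  proof (rule lipschitz_onI)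
    show "0 \<le> (\<Sum>j\<in>UNIV. L j)" using L lipschitz_on_nonneg by (intro sum_nonneg) blast
    fix x y assume xy: "x \<in> S" "y \<in> S"
    have "dist (f x) (f y) \<le> (\<Sum>j\<in>UNIV. \<bar>(f x - f y) $ j\<bar>)" unfolding dist_norm by (rule norm_le_l1_cart)
    also have "\<dots> \<le> (\<Sum>j\<in>UNIV. L j * dist x y)"
      using lipschitz_onD[OF L xy] by (intro sum_mono) (simp add: dist_real_def)
    finally show "dist (f x) (f y) \<le> (\<Sum>j\<in>UNIV. L j) * dist x y" by (simp add: sum_distrib_right)
  qed
  then show ?thesis by blast
qed

lemma lipschitz_on_ex_nth: "\<exists>L. L-lipschitz_on S (\<lambda>x :: real ^ 'n. x $ j)"
  by (intro exI[of _ 1] lipschitz_onI) (auto simp: dist_vec_nth_le)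

definition T_potential :: "real \<Rightarrow> real \<Rightarrow> real \<Rightarrow> real \<Rightarrow> real ^ 3 \<Rightarrow> real" where
  "T_potential \<mu> \<beta> K0 K2 A =
    \<mu> / 2 * ((A$1)^2 + (A$2)^2 + (A$3)^2) + \<beta> * (A$1 * A$2 * A$3)
    + K0 / 4 * ((A$1)^4 + (A$2)^4 + (A$3)^4)
    + K2 / 2 * ((A$1)^2 * (A$2)^2 + (A$1)^2 * (A$3)^2 + (A$2)^2 * (A$3)^2)"

definition T_gradient :: "real \<Rightarrow> real \<Rightarrow> real \<Rightarrow> real \<Rightarrow> real ^ 3 \<Rightarrow> real ^ 3" where
  "T_gradient \<mu> \<beta> K0 K2 A = vector [
    \<mu> * A$1 + \<beta> * A$2 * A$3 + (K0 * (A$1)^2 + K2 * ((A$2)^2 + (A$3)^2)) * A$1,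
    \<mu> * A$2 + \<beta> * A$1 * A$3 + (K0 * (A$2)^2 + K2 * ((A$1)^2 + (A$3)^2)) * A$2,
    \<mu> * A$3 + \<beta> * A$1 * A$2 + (K0 * (A$3)^2 + K2 * ((A$1)^2 + (A$2)^2)) * A$3]"

definition mass :: "real \<Rightarrow> 3 \<Rightarrow> real" where
  "mass \<theta> j = 4 * (dvec \<theta> \<bullet> kvec j)\<^sup>2"

text \<open>
  The three scalar products are \<open>cos \<theta>\<close>, \<open>- cos (\<theta> + pi / 3)\<close> and \<open>- cos (\<theta> - pi / 3)\<close>; on the given interval the
  angles stay away from the zeros of the cosine.
\<close>

lemma mass_pos:
  assumes "\<theta> \<in> {0<..<pi / 6}"
  shows "mass \<theta> j > 0"
proof -
  have c: "cos \<theta> > 0" and s: "sin \<theta> > 0"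
    using assms pi_gt_zero by (auto intro!: cos_gt_zero sin_gt_zero)
  have "cos (\<theta> + pi / 3) > 0" using assms pi_gt_zero by (intro cos_gt_zero) auto
  then have "cos \<theta> > sqrt 3 * sin \<theta>" by (simp add: cos_add cos_60 sin_60 mult.commute)
  moreover have "sqrt 3 * sin \<theta> > 0" using s by simp
  ultimately have "dvec \<theta> \<bullet> kvec j \<noteq> 0"
    using c exhaust_3[of j] by (auto simp: dvec_def kvec_def inner_vec_def sum_2 vector_2 algebra_simps)
  then show ?thesis by (simp add: mass_def)
qed

lemma T_gradient_has_derivative:
  "(T_potential \<mu> \<beta> K0 K2 has_derivative (\<lambda>h. T_gradient \<mu> \<beta> K0 K2 x \<bullet> h)) (at x)"
proof -
  have nth: "((\<lambda>x. x $ j) has_derivative (\<lambda>h. h $ j)) (at x)" for j :: 3 and x :: "real ^ 3"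
    by (rule bounded_linear_imp_has_derivative) (rule bounded_linear_vec_nth)
  show ?thesis
    unfolding T_potential_def T_gradient_def
    apply (rule has_derivative_eq_rhs)
     apply (rule derivative_intros nth)+
    apply (rule ext)
    apply (simp add: inner_vec_def sum_3 vector_3)
    apply (simp add: field_simps power2_eq_square power3_eq_cube)
    done
qed

lemma T_gradient_lipschitz: "\<exists>L. L-lipschitz_on (cball 0 R) (T_gradient \<mu> \<beta> K0 K2)"
proof (rule lipschitz_on_ex_vec)
  fix j :: 3
  show "\<exists>L. L-lipschitz_on (cball 0 R) (\<lambda>x. T_gradient \<mu> \<beta> K0 K2 x $ j)"
    unfolding T_gradient_def
    by (rule disjE[OF exhaust_3[of j]]; (elim disjE)?; simp only: vector_3)
      (intro lipschitz_on_ex_add lipschitz_on_bounded_mult lipschitz_on_ex_power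
        lipschitz_on_ex_const lipschitz_on_ex_nth bounded_cball)+
qed

lemma T_damped_gradient_system:
  assumes "\<theta> \<in> {0<..<pi / 6}" "c0 > 0"
  shows "damped_gradient_system (T_potential \<mu> \<beta> K0 K2) (T_gradient \<mu> \<beta> K0 K2)
    (\<lambda>x. \<chi> j. mass \<theta> j * x $ j) (\<lambda>x. \<chi> j. x $ j / mass \<theta> j) c0 (Min (range (mass \<theta>)))"
proof (rule damped_gradient_system.intro)
  note pos = mass_pos[OF assms(1)]
  show "Min (range (mass \<theta>)) > 0" using pos by simp
  show "linear (\<lambda>x :: real ^ 3. \<chi> j. mass \<theta> j * x $ j)"
    by (rule linearI) (auto simp: vec_eq_iff algebra_simps)
  show "linear (\<lambda>x :: real ^ 3. \<chi> j. x $ j / mass \<theta> j)"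
    by (rule linearI) (auto simp: vec_eq_iff add_divide_distrib)
  show "x \<bullet> (\<chi> j. mass \<theta> j * y $ j) = (\<chi> j. mass \<theta> j * x $ j) \<bullet> y" for x y :: "real ^ 3"
    by (simp add: inner_vec_def mult_ac)
  show "(\<chi> j. mass \<theta> j * (\<chi> j. x $ j / mass \<theta> j) $ j) = x" for x :: "real ^ 3"
    using pos by (simp add: vec_eq_iff less_imp_neq[symmetric])
  show "Min (range (mass \<theta>)) * (x \<bullet> x) \<le> x \<bullet> (\<chi> j. mass \<theta> j * x $ j)" for x :: "real ^ 3"
    unfolding inner_vec_def sum_distrib_left
  proof (rule sum_mono)
    fix j :: 3
    have "Min (range (mass \<theta>)) * (x $ j * x $ j) \<le> mass \<theta> j * (x $ j * x $ j)"
      by (intro mult_right_mono) auto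
    then show "Min (range (mass \<theta>)) * (x $ j \<bullet> x $ j) \<le> x $ j \<bullet> (\<chi> j. mass \<theta> j * x $ j) $ j"
      by (simp add: mult_ac)
  qed
qed (use assms T_gradient_has_derivative T_gradient_lipschitz in auto)

lemma enumerate_index_triple:
  assumes "{j, l, m} = (UNIV :: 3 set)"
  shows "(j, l, m) \<in> {(1,2,3), (1,3,2), (2,1,3), (2,3,1), (3,1,2), (3,2,1)}"
proof -
  have neq: "(1::3) \<noteq> 2" "(1::3) \<noteq> 3" "(2::3) \<noteq> 3" by simp_all
  have "1 \<in> {j, l, m}" "2 \<in> {j, l, m}" "3 \<in> {j, l, m}" using assms by (simp_all only: UNIV_I)
  then have "j \<noteq> l" "j \<noteq> m" "l \<noteq> m"
    using neq by (metis insert_absorb2 insert_commute insert_iff singletonD)+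
  then show ?thesis using exhaust_3[of j] exhaust_3[of l] exhaust_3[of m] by (elim disjE; simp)
qed

lemma T_gradient_component:
  assumes "{j, l, m} = (UNIV :: 3 set)"
  shows "T_gradient \<mu> \<beta> K0 K2 A $ j =
    \<mu> * A$j + \<beta> * A$l * A$m + (K0 * (A$j)^2 + K2 * ((A$l)^2 + (A$m)^2)) * A$j"
  using enumerate_index_triple[OF assms] by (auto simp: T_gradient_def algebra_simps)

lemma solution_T_intro:
  assumes \<theta>: "\<theta> \<in> {0<..<pi / 6}"
    and A: "\<And>t j. ((\<lambda>t. A t $ j) has_real_derivative B t $ j) (at t)"
    and B: "\<And>t j. ((\<lambda>t. B t $ j) has_real_derivative
        (- c0 * B t $ j - T_gradient \<mu> \<beta> K0 K2 (A t) $ j) / mass \<theta> j) (at t)"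
  shows "solution_T \<theta> \<mu> c0 \<beta> K0 K2 A B"
  unfolding solution_T_def
proof (intro allI impI conjI A)
  fix t j l m assume jlm: "{j, l, m} = (UNIV :: 3 set)"
  have "mass \<theta> j \<noteq> 0" using mass_pos[OF \<theta>, of j] by simp
  then have "4 * (dvec \<theta> \<bullet> kvec j)\<^sup>2 * ((- c0 * B t $ j - T_gradient \<mu> \<beta> K0 K2 (A t) $ j) / mass \<theta> j)
      = - c0 * B t $ j - T_gradient \<mu> \<beta> K0 K2 (A t) $ j"
    unfolding mass_def by simp
  then show "\<exists>B'. ((\<lambda>x. B x $ j) has_real_derivative B') (at t) \<and>
      4 * (dvec \<theta> \<bullet> kvec j)\<^sup>2 * B' = - \<mu> * A t $ j - c0 * B t $ j - \<beta> * A t $ l * A t $ m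
        - (K0 * (A t $ j)\<^sup>2 + K2 * ((A t $ l)\<^sup>2 + (A t $ m)\<^sup>2)) * A t $ j"
    using B[of j t] T_gradient_component[OF jlm, of \<mu> \<beta> K0 K2 "A t"]
    by (intro exI conjI) (assumption, simp)
qed

lemma equilibrium_T_intro:
  assumes "\<theta> \<in> {0<..<pi / 6}" "T_gradient \<mu> \<beta> K0 K2 p = 0"
  shows "equilibrium_T \<theta> \<mu> c0 \<beta> K0 K2 (p, 0)"
  unfolding equilibrium_T_def using assms by (intro solution_T_intro) auto

lemma heteroclinic_T_intro:
  assumes \<theta>: "\<theta> \<in> {0<..<pi / 6}" and p: "T_gradient \<mu> \<beta> K0 K2 p = 0" "p \<noteq> 0"
    and z: "\<And>t. (z has_vector_derivative
      (snd (z t), \<chi> j. (- c0 *\<^sub>R snd (z t) - T_gradient \<mu> \<beta> K0 K2 (fst (z t))) $ j / mass \<theta> j)) (at t)"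
    and lim: "(z \<longlongrightarrow> (p, 0)) at_bot" "(z \<longlongrightarrow> 0) at_top"
  shows "\<exists>A B. heteroclinic_T \<theta> \<mu> c0 \<beta> K0 K2 (p, 0) (A_T, 0) A B"
proof -
  have AT: "A_T = 0" by (simp add: A_T_def vec_eq_iff forall_3 vector_3)
  have nth: "((\<lambda>t. f t $ j) has_real_derivative f' $ j) (at t)"
    if "(f has_vector_derivative f') (at t)" for f f' t and j :: 3
    using bounded_linear.has_vector_derivative[OF bounded_linear_vec_nth that]
    by (simp add: has_real_derivative_iff_has_vector_derivative)
  have fs: "((\<lambda>t. fst (z t)) has_vector_derivative snd (z t)) (at t)"
    "((\<lambda>t. snd (z t)) has_vector_derivative
      (\<chi> j. (- c0 *\<^sub>R snd (z t) - T_gradient \<mu> \<beta> K0 K2 (fst (z t))) $ j / mass \<theta> j)) (at t)" for t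
    using bounded_linear.has_vector_derivative[OF bounded_linear_fst z]
      bounded_linear.has_vector_derivative[OF bounded_linear_snd z] by simp_all
  have "solution_T \<theta> \<mu> c0 \<beta> K0 K2 (\<lambda>t. fst (z t)) (\<lambda>t. snd (z t))"
    using nth[OF fs(1)] nth[OF fs(2)] by (intro solution_T_intro \<theta>) auto
  moreover have "T_gradient \<mu> \<beta> K0 K2 0 = 0"
    by (simp add: T_gradient_def vec_eq_iff forall_3 vector_3)
  ultimately have "equilibrium_T \<theta> \<mu> c0 \<beta> K0 K2 (0, 0)" "equilibrium_T \<theta> \<mu> c0 \<beta> K0 K2 (p, 0)"
    "solution_T \<theta> \<mu> c0 \<beta> K0 K2 (\<lambda>t. fst (z t)) (\<lambda>t. snd (z t))"
    using equilibrium_T_intro[OF \<theta>] p by blast+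
  then have "heteroclinic_T \<theta> \<mu> c0 \<beta> K0 K2 (p, 0) (A_T, 0) (\<lambda>t. fst (z t)) (\<lambda>t. snd (z t))"
    unfolding heteroclinic_T_def AT using p lim by (simp add: zero_prod_def)
  then show ?thesis by (intro exI)
qed

section \<open>The connections from hexagons and from rolls\<close>

text \<open>
  The hypothesis \<open>hex\<close> makes the hexagon an equilibrium, and \<open>gap\<close> isolates it: for a critical point \<open>(u, v, w)\<close>,
  \<open>u\<close> times the first equation minus \<open>v\<close> times the second is
  \<open>(u\<^sup>2 - v\<^sup>2) * (\<mu> + K0 * (u\<^sup>2 + v\<^sup>2) + K2 * w\<^sup>2)\<close>, and the last factor is positive near the hexagon. So all three
  components agree there, and what remains is a quadratic equation with only one negative root.
\<close>

lemma hexagon_heteroclinic: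
  fixes N :: "real ^ 3 \<Rightarrow> real"
  assumes \<theta>: "\<theta> \<in> {0<..<pi / 6}" and c0: "c0 > 0"
    and h: "h > 0" and \<beta>: "\<beta> \<ge> 0" and K: "K0 < 0" "K2 < 0" and \<mu>: "\<mu> > 0"
    and hex: "\<mu> = \<beta> * h - (K0 + 2 * K2) * h^2"
    and gap: "\<mu> + 2 * K0 * h^2 + K2 * h^2 > 0"
    and N: "continuous_on UNIV N" "\<And>s x. N (s *\<^sub>R x) = s^2 * N x" "n > 0" "\<And>x. n * (x \<bullet> x) \<le> N x"
      "N (vector [- h, - h, - h]) = 1"
    and barrier: "\<And>x. N x = 1 \<Longrightarrow>
      \<mu> / 2 * (3 * h^2) - \<beta> * h^3 + 3 / 4 * (K0 + 2 * K2) * h^4 \<le> T_potential \<mu> \<beta> K0 K2 x"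
  shows "\<exists>A B. heteroclinic_T \<theta> \<mu> c0 \<beta> K0 K2 (vector [- h, - h, - h], 0) (A_T, 0) A B"
proof -
  define p :: "real ^ 3" where "p = vector [- h, - h, - h]"
  have pj: "p $ 1 = - h" "p $ 2 = - h" "p $ 3 = - h" by (simp_all add: p_def)
  interpret D: damped_gradient_system "T_potential \<mu> \<beta> K0 K2" "T_gradient \<mu> \<beta> K0 K2"
    "\<lambda>x. \<chi> j. mass \<theta> j * x $ j" "\<lambda>x. \<chi> j. x $ j / mass \<theta> j" c0 "Min (range (mass \<theta>))"
    by (rule T_damped_gradient_system[OF \<theta> c0])
  have "\<mu> * h = \<beta> * h^2 - (K0 + 2 * K2) * h^3"
    by (simp add: hex algebra_simps power2_eq_square power3_eq_cube)
  then have Gp: "T_gradient \<mu> \<beta> K0 K2 p = 0"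
    by (simp add: T_gradient_def vec_eq_iff forall_3 pj power2_eq_square power3_eq_cube algebra_simps)
  define F where "F u v w = \<mu> + K0 * (u^2 + v^2) + K2 * w^2" for u v w :: real
  define U where "U = {x :: real ^ 3. x$1 < 0 \<and> x$2 < 0 \<and> x$3 < 0 \<and> 0 < F (x$1) (x$2) (x$3) \<and> 0 < F (x$1) (x$3) (x$2)}"
  have "open U" unfolding U_def F_def
    by (intro open_Collect_conj open_Collect_less continuous_intros)
  moreover have "p \<in> U" using h gap by (simp add: U_def F_def pj algebra_simps)
  ultimately obtain r where r: "r > 0" "ball p r \<subseteq> U" by (rule openE)
  have crit: "x = p" if "dist x p < r" and G: "T_gradient \<mu> \<beta> K0 K2 x = 0" for x
  proof -
    obtain u v w where uvw: "u = x$1" "v = x$2" "w = x$3" by blast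
    have U: "u < 0" "v < 0" "w < 0" "0 < F u v w" "0 < F u w v"
      using r that(1) unfolding uvw by (auto simp: U_def dist_commute)
    have g: "\<mu> * u + \<beta> * v * w + (K0 * u^2 + K2 * (v^2 + w^2)) * u = 0"
      "\<mu> * v + \<beta> * u * w + (K0 * v^2 + K2 * (u^2 + w^2)) * v = 0"
      "\<mu> * w + \<beta> * u * v + (K0 * w^2 + K2 * (u^2 + v^2)) * w = 0"
      using G unfolding uvw by (simp_all add: T_gradient_def vec_eq_iff forall_3)
    have "u * (\<mu> * u + \<beta> * v * w + (K0 * u^2 + K2 * (v^2 + w^2)) * u)
        - v * (\<mu> * v + \<beta> * u * w + (K0 * v^2 + K2 * (u^2 + w^2)) * v) = (u^2 - v^2) * F u v w"
      by (simp add: F_def power2_eq_square algebra_simps)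
    then have "u^2 = v^2" using g U by simp
    then have uv: "v = u" using U by (simp add: power2_eq_iff)
    have "u * (\<mu> * u + \<beta> * v * w + (K0 * u^2 + K2 * (v^2 + w^2)) * u)
        - w * (\<mu> * w + \<beta> * u * v + (K0 * w^2 + K2 * (u^2 + v^2)) * w) = (u^2 - w^2) * F u w v"
      by (simp add: F_def power2_eq_square algebra_simps)
    then have "u^2 = w^2" using g U by simp
    then have uw: "w = u" using U by (simp add: power2_eq_iff)
    have "u * ((u + h) * (\<beta> + (K0 + 2 * K2) * (u - h))) = 0"
      using g(1) unfolding uv uw hex by (simp add: power2_eq_square algebra_simps)
    moreover have "(K0 + 2 * K2) * (u - h) > 0" using K U h by (intro mult_neg_neg) auto
    ultimately have "u = - h" using U \<beta> by auto
    then show ?thesis using uv uw uvw by (simp add: vec_eq_iff forall_3 pj)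
  qed
  define a b d where "a x = \<mu> * (x \<bullet> x)" and "b x = \<beta> * (x$1 * x$2 * x$3)"
    and "d x = - (K0 * ((x$1)^4 + (x$2)^4 + (x$3)^4)
      + 2 * K2 * ((x$1)^2 * (x$2)^2 + (x$1)^2 * (x$3)^2 + (x$2)^2 * (x$3)^2))" for x :: "real ^ 3"
  obtain z where z: "\<And>t. (z has_vector_derivative D.field (z t)) (at t)"
    "(z \<longlongrightarrow> (p, 0)) at_bot" "(z \<longlongrightarrow> 0) at_top"
  proof (rule D.quartic_heteroclinic_connection[of a b d N n p r])
    show "T_potential \<mu> \<beta> K0 K2 (s *\<^sub>R x) = a x / 2 * s^2 + b x * s^3 - d x / 4 * s^4" for s x
      by (simp add: T_potential_def a_def b_def d_def inner_vec_def sum_3 field_simps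
          power2_eq_square power3_eq_cube power4_eq_xxxx)
    show "0 < a x" if "x \<noteq> 0" for x using that \<mu> by (simp add: a_def)
    show "0 \<le> d x" for x
    proof -
      have "0 \<le> (- K0) * ((x$1)^4 + (x$2)^4 + (x$3)^4)
        + 2 * (- K2) * ((x$1)^2 * (x$2)^2 + (x$1)^2 * (x$3)^2 + (x$2)^2 * (x$3)^2)"
        using K by (intro add_nonneg_nonneg mult_nonneg_nonneg) auto
      then show ?thesis by (simp add: d_def)
    qed
    have "T_potential \<mu> \<beta> K0 K2 p = \<mu> / 2 * (3 * h^2) - \<beta> * h^3 + 3 / 4 * (K0 + 2 * K2) * h^4"
      by (simp add: T_potential_def pj power2_eq_square power3_eq_cube power4_eq_xxxx field_simps)
    then show "T_potential \<mu> \<beta> K0 K2 p \<le> T_potential \<mu> \<beta> K0 K2 x" if "N x = 1" for x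
      using barrier[OF that] by simp
    show "x = p" if "dist x p < r" "T_gradient \<mu> \<beta> K0 K2 x = 0" for x using crit that .
  qed (use N r Gp in \<open>auto simp: p_def\<close>)
  have "p \<noteq> 0" using pj h by (metis neg_equal_0_iff_equal order_less_irrefl zero_index)
  then have "\<exists>A B. heteroclinic_T \<theta> \<mu> c0 \<beta> K0 K2 (p, 0) (A_T, 0) A B"
    using z by (intro heteroclinic_T_intro \<theta> Gp) (auto simp: D.field_def)
  then show ?thesis by (simp add: p_def)
qed

lemma A_H_minus_eq:
  assumes "\<beta> \<ge> 0" "K0 < 0" "K2 < 0" "\<mu> > 0"
  obtains h where "h > 0" "\<mu> = \<beta> * h - (K0 + 2 * K2) * h^2" "A_H_minus \<mu> \<beta> K0 K2 = vector [- h, - h, - h]"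
proof -
  define k where "k = - (K0 + 2 * K2)"
  define s where "s = sqrt (\<beta>^2 + 4 * \<mu> * k)"
  define h where "h = (s - \<beta>) / (2 * k)"
  have k: "k > 0" using assms by (simp add: k_def)
  have s2: "s^2 = \<beta>^2 + 4 * \<mu> * k" using assms k by (simp add: s_def)
  have "\<beta> < s" unfolding s_def using assms k by (intro real_less_rsqrt) simp
  then have "h > 0" using k by (simp add: h_def)
  have "2 * k * h = s - \<beta>" using k by (simp add: h_def)
  then have "(2 * k * h + \<beta>)^2 = s^2" by simp
  then have "4 * k * (k * h^2 + \<beta> * h) = 4 * k * \<mu>"
    unfolding s2 by (simp add: power2_eq_square algebra_simps)
  then have "\<mu> = k * h^2 + \<beta> * h" using k by simp
  have a: "(- \<beta> + sqrt (\<beta>\<^sup>2 - 4 * \<mu> * (K0 + 2 * K2))) / (2 * (K0 + 2 * K2)) = - h"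
  proof -
    have eq: "\<beta>\<^sup>2 - 4 * \<mu> * (K0 + 2 * K2) = \<beta>^2 + 4 * \<mu> * k" "2 * (K0 + 2 * K2) = - (2 * k)"
      by (simp_all add: k_def algebra_simps)
    show ?thesis unfolding eq s_def[symmetric] h_def by simp
  qed
  have "A_H_minus \<mu> \<beta> K0 K2 = vector [- h, - h, - h]"
    unfolding A_H_minus_def Let_def a by simp
  with \<open>h > 0\<close> \<open>\<mu> = k * h^2 + \<beta> * h\<close> show ?thesis
    by (intro that[of h]) (auto simp: k_def algebra_simps)
qed

lemma hexagon_connection_strong_coupling:
  assumes \<theta>: "\<theta> \<in> {0<..<pi / 6}" and c0: "c0 > 0" and \<beta>: "\<beta> \<ge> 0" and K: "K0 < 0" "K2 < K0" and \<mu>: "\<mu> > 0"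
  shows "\<exists>A B. heteroclinic_T \<theta> \<mu> c0 \<beta> K0 K2 (A_H_minus \<mu> \<beta> K0 K2, 0) (A_T, 0) A B"
proof -
  have K2: "K2 < 0" using K by simp
  obtain h where h: "h > 0" and hex: "\<mu> = \<beta> * h - (K0 + 2 * K2) * h^2"
    and A: "A_H_minus \<mu> \<beta> K0 K2 = vector [- h, - h, - h]"
    by (rule A_H_minus_eq[OF \<beta> K(1) K2 \<mu>])
  have "\<mu> + 2 * K0 * h^2 + K2 * h^2 = \<beta> * h + (K0 - K2) * h^2" by (simp add: hex algebra_simps)
  moreover have "\<beta> * h \<ge> 0" "(K0 - K2) * h^2 > 0" using \<beta> h K by simp_all
  ultimately have gap: "\<mu> + 2 * K0 * h^2 + K2 * h^2 > 0" by linarith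
  show ?thesis unfolding A
  proof (rule hexagon_heteroclinic[where N = "\<lambda>x. (x \<bullet> x) / (3 * h^2)" and n = "1 / (3 * h^2)"])
    fix x :: "real ^ 3" assume "x \<bullet> x / (3 * h^2) = 1"
    then have "(x$1)^2 + (x$2)^2 + (x$3)^2 = 3 * h^2"
      using h by (simp add: inner_vec_def sum_3 power2_eq_square field_simps)
    with hexagon_barrier_sphere[OF h _ \<beta> this, of K2 K0 \<mu>] K
    show "\<mu> / 2 * (3 * h^2) - \<beta> * h^3 + 3 / 4 * (K0 + 2 * K2) * h^4 \<le> T_potential \<mu> \<beta> K0 K2 x"
      by (simp add: T_potential_def)
  next
    show "((s *\<^sub>R x) \<bullet> (s *\<^sub>R x)) / (3 * h^2) = s^2 * ((x \<bullet> x) / (3 * h^2))" for s and x :: "real ^ 3"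
      by (simp add: power2_eq_square)
  qed (use \<theta> c0 h \<beta> K K2 \<mu> hex gap in
      \<open>auto simp: inner_vec_def sum_3 power2_eq_square intro!: continuous_intros\<close>)
qed

text \<open>
  The parameter \<open>r\<close> removes the radicals from \<open>\<mu>1\<close>: since \<open>K0 + K2 = K0 * r\<^sup>2 / 2\<close>, the argument of the square
  root is half of a perfect square, and the denominator factors. In particular it is positive.
\<close>

lemma \<mu>1_eq:
  assumes K: "K0 < 0" "K0 < K2" "K2 < 0"
  defines "r \<equiv> sqrt (2 * (1 + K2 / K0))"
  shows "0 < r" "r < 2" "1 < r" "K2 = K0 * (r^2 - 2) / 2"
    "\<mu>1 \<beta> K0 K2 = \<beta>^2 / (- K0 * (2 - r)^2 * (1 + r))"
proof -
  have q: "0 < K2 / K0" "K2 / K0 < 1" using K by (simp_all add: divide_less_eq zero_less_divide_iff)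
  have r2: "r^2 = 2 * (1 + K2 / K0)" using q by (simp add: r_def)
  show r1: "1 < r" unfolding r_def using q by (intro real_less_rsqrt) simp
  then show r0: "0 < r" by simp
  show r4: "r < 2" unfolding r_def using q by (intro real_less_lsqrt) auto
  show K2: "K2 = K0 * (r^2 - 2) / 2" using K by (simp add: r2)
  have sum: "K0 + K2 = K0 * r^2 / 2" "K0 + 3 * K2 = K0 * (3 * r^2 - 4) / 2"
    using K2 by (simp_all add: field_simps)
  have "sqrt 2 * sqrt (K0 * (K0 + K2) ^ 3) = sqrt (2 * (K0 * (K0 + K2) ^ 3))"
    by (simp add: real_sqrt_mult)
  also have "2 * (K0 * (K0 + K2) ^ 3) = (K0^2 * r^3 / 2)^2"
    unfolding sum(1) by (simp add: power2_eq_square power3_eq_cube field_simps)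
  also have "sqrt \<dots> = K0^2 * r^3 / 2" using r0 by simp
  finally have sq: "2 * sqrt 2 * sqrt (K0 * (K0 + K2) ^ 3) = K0^2 * r^3" by simp
  have den: "K0^2 * r^3 - 2 * K0 * (K0 + 3 * K2) = K0 * (K0 * ((2 - r)^2 * (1 + r)))"
    unfolding sum(2) by (simp add: power2_eq_square power3_eq_cube field_simps)
  show "\<mu>1 \<beta> K0 K2 = \<beta>^2 / (- K0 * (2 - r)^2 * (1 + r))"
    unfolding \<mu>1_def sq den using K r0 r4 by (simp add: mult.assoc)
qed

text \<open>
  In terms of \<open>b = \<beta> / (- K0 * h)\<close> the inequality between \<open>\<mu>\<close> and the threshold is a quadratic inequality whose
  positive root is \<open>(2 - r) * (1 + r)\<close>, the value for which hexagons and rolls have the same level.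
\<close>

lemma hexagons_below_rolls:
  fixes \<mu> \<beta> K0 r h :: real
  assumes r: "1 < r" "r < 2" and K0: "K0 < 0" and h: "h > 0" and \<beta>: "\<beta> \<ge> 0"
    and hex: "\<mu> = \<beta> * h - K0 * (r^2 - 1) * h^2"
    and less: "\<mu> < \<beta>^2 / (- K0 * (2 - r)^2 * (1 + r))"
  shows "(2 - r) * (1 + r) < \<beta> / (- K0 * h)"
proof (rule ccontr)
  define b where "b = \<beta> / (- K0 * h)"
  assume "\<not> ?thesis"
  then have b: "0 \<le> b" "b \<le> (2 - r) * (1 + r)"
    using K0 h \<beta> by (auto simp: b_def divide_nonneg_neg mult_neg_pos not_less)
  have \<beta>b: "\<beta> = - K0 * h * b" using K0 h by (simp add: b_def)
  have pos: "0 < - K0 * (2 - r)^2 * (1 + r)" using K0 r by (intro mult_pos_pos) auto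
  have "\<mu> * (- K0 * (2 - r)^2 * (1 + r)) < \<beta>^2"
    using less pos by (simp only: pos_less_divide_eq)
  moreover have "\<mu> * (- K0 * (2 - r)^2 * (1 + r)) = K0^2 * h^2 * ((b + (r^2 - 1)) * ((2 - r)^2 * (1 + r)))"
    unfolding hex \<beta>b by (simp add: power2_eq_square algebra_simps)
  moreover have "\<beta>^2 = K0^2 * h^2 * b^2" unfolding \<beta>b by (simp add: power_mult_distrib)
  ultimately have "K0^2 * h^2 * ((b + (r^2 - 1)) * ((2 - r)^2 * (1 + r))) < K0^2 * h^2 * b^2" by simp
  then have "(b + (r^2 - 1)) * ((2 - r)^2 * (1 + r)) < b^2"
    by (rule mult_left_less_imp_less) simp
  moreover have "(b + (r^2 - 1)) * ((2 - r)^2 * (1 + r)) - b^2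
      = ((2 - r) * (1 + r) - b) * (b + (2 - r) * (r^2 - 1))"
    by (simp add: power2_eq_square algebra_simps)
  moreover have "0 \<le> ((2 - r) * (1 + r) - b) * (b + (2 - r) * (r^2 - 1))"
  proof -
    have "1 \<le> r^2" using r by (simp add: power2_eq_square less_imp_le mult_ge1_I)
    then show ?thesis using b r by (intro mult_nonneg_nonneg add_nonneg_nonneg) auto
  qed
  ultimately show False by linarith
qed

text \<open>
  All coefficients are expressed through \<open>h\<close>, \<open>r\<close>, \<open>b\<close> and \<open>k = - K0\<close>; the potential is then \<open>k * h\<^sup>4\<close> times the
  normalized quartic of \<open>hexagon_barrier_weighted\<close> at the point \<open>(X, Y, Z)\<close>.
\<close>

lemma hexagon_connection_weak_coupling:
  assumes \<theta>: "\<theta> \<in> {0<..<pi / 6}" and c0: "c0 > 0" and \<beta>: "\<beta> \<ge> 0" and K: "K0 < K2" "K2 < 0"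
    and \<mu>: "\<mu> > 0" "\<mu> < \<mu>1 \<beta> K0 K2"
  shows "\<exists>A B. heteroclinic_T \<theta> \<mu> c0 \<beta> K0 K2 (A_H_minus \<mu> \<beta> K0 K2, 0) (A_T, 0) A B"
proof -
  have K0: "K0 < 0" using K by simp
  define r where "r = sqrt (2 * (1 + K2 / K0))"
  note r = \<mu>1_eq[OF K0 K, folded r_def]
  obtain h where h: "h > 0" and hex: "\<mu> = \<beta> * h - (K0 + 2 * K2) * h^2"
    and A: "A_H_minus \<mu> \<beta> K0 K2 = vector [- h, - h, - h]"
    by (rule A_H_minus_eq[OF \<beta> K0 K(2) \<mu>(1)])
  have hex': "\<mu> = \<beta> * h - K0 * (r^2 - 1) * h^2"
    unfolding hex by (subst r(4)) (simp add: field_simps)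
  define k b where "k = - K0" and "b = \<beta> / (- K0 * h)"
  have k: "k > 0" "K0 = - k" using K0 by (simp_all add: k_def)
  have bh: "\<beta> = k * h * b" using k h by (simp add: b_def)
  have b: "(2 - r) * (1 + r) < b"
    unfolding b_def by (rule hexagons_below_rolls[OF r(3,2) K0 h \<beta> hex' \<mu>(2)[unfolded r(5)]])
  have \<mu>eq: "\<mu> = k * h^2 * (r^2 - 1 + b)"
    unfolding hex' bh k by (simp add: power2_eq_square algebra_simps)
  have K2: "K2 = - k * (r^2 - 2) / 2" using r(4) k by simp
  have "\<mu> + 2 * K0 * h^2 + K2 * h^2 = k * h^2 * (b - (4 - r^2) / 2)"
    unfolding \<mu>eq K2 k(2) by (simp add: field_simps)
  moreover have "b - (4 - r^2) / 2 > 0"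
  proof -
    have "(4 - r^2) / 2 = (2 - r) * (1 + r / 2)" by (simp add: power2_eq_square field_simps)
    also have "\<dots> \<le> (2 - r) * (1 + r)" using r by (intro mult_left_mono) auto
    finally show ?thesis using b by simp
  qed
  ultimately have gap: "\<mu> + 2 * K0 * h^2 + K2 * h^2 > 0" using k h by simp
  define N :: "real ^ 3 \<Rightarrow> real" where
    "N x = (r / 2 * (x \<bullet> x) + (1 - r / 2) * max ((x$1)^2) (max ((x$2)^2) ((x$3)^2))) / ((1 + r) * h^2)" for x
  have pos: "(1 + r) * h^2 > 0" using r h by simp
  have N1: "r / 2 * ((x$1 / h)^2 + (x$2 / h)^2 + (x$3 / h)^2)
      + (1 - r / 2) * max ((x$1 / h)^2) (max ((x$2 / h)^2) ((x$3 / h)^2)) = (1 + r) * N x" for x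
  proof -
    have m: "max (u / h^2) (v / h^2) = max u v / h^2" for u v :: real
      using h by (simp add: max_def divide_le_cancel)
    have "(1 + r) * N x = (r / 2 * ((x$1)^2 + (x$2)^2 + (x$3)^2)
        + (1 - r / 2) * max ((x$1)^2) (max ((x$2)^2) ((x$3)^2))) / h^2"
      unfolding N_def using r by (simp add: inner_vec_def sum_3 power2_eq_square)
    then show ?thesis unfolding power_divide m by (simp add: add_divide_distrib distrib_left)
  qed
  show ?thesis unfolding A
  proof (rule hexagon_heteroclinic[where N = N and n = "(r / 2) / ((1 + r) * h^2)"])
    show "continuous_on UNIV N" unfolding N_def using r h by (intro continuous_intros) auto
    show "N (s *\<^sub>R x) = s^2 * N x" for s x
    proof -
      have m: "max (s^2 * u) (s^2 * v) = s^2 * max u v" for u v :: real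
        by (simp add: max_def mult_le_cancel_left)
      show ?thesis unfolding N_def by (simp add: power_mult_distrib m algebra_simps) (simp add: power2_eq_square algebra_simps)
    qed
    show "(r / 2) / ((1 + r) * h^2) * (x \<bullet> x) \<le> N x" for x
    proof -
      have "0 \<le> (1 - r / 2) * max ((x$1)^2) (max ((x$2)^2) ((x$3)^2))"
        using r by (intro mult_nonneg_nonneg) (auto simp: le_max_iff_disj)
      then have "(r / 2 * (x \<bullet> x)) / ((1 + r) * h^2) \<le> N x"
        unfolding N_def using pos by (intro divide_right_mono) linarith+
      then show ?thesis by simp
    qed
    show "N (vector [- h, - h, - h]) = 1"
      using pos unfolding N_def by (simp add: inner_vec_def sum_3 power2_eq_square field_simps)
    fix x :: "real ^ 3" assume "N x = 1"
    define X Y Z where XYZ: "X = x$1 / h" "Y = x$2 / h" "Z = x$3 / h"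
    have x: "x$1 = h * X" "x$2 = h * Y" "x$3 = h * Z" using h by (simp_all add: XYZ)
    have "3 * (r^2 - 1) / 4 + b / 2 \<le> (r^2 - 1 + b) / 2 * (X^2 + Y^2 + Z^2) + b * (X * Y * Z)
        - ((X^2 + Y^2 + Z^2)^2 - (4 - r^2) * (X^2 * Y^2 + X^2 * Z^2 + Y^2 * Z^2)) / 4"
      using N1[of x] \<open>N x = 1\<close> r b unfolding XYZ by (intro hexagon_barrier_weighted) auto
    then have "k * h^4 * (3 * (r^2 - 1) / 4 + b / 2) \<le> k * h^4 * ((r^2 - 1 + b) / 2 * (X^2 + Y^2 + Z^2) + b * (X * Y * Z)
        - ((X^2 + Y^2 + Z^2)^2 - (4 - r^2) * (X^2 * Y^2 + X^2 * Z^2 + Y^2 * Z^2)) / 4)"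
      using k by (intro mult_left_mono) auto
    also have "\<dots> = T_potential \<mu> \<beta> K0 K2 x"
      unfolding T_potential_def x \<mu>eq bh K2 k(2)
      by (simp add: field_simps power2_eq_square power4_eq_xxxx)
    also have "k * h^4 * (3 * (r^2 - 1) / 4 + b / 2)
        = \<mu> / 2 * (3 * h^2) - \<beta> * h^3 + 3 / 4 * (K0 + 2 * K2) * h^4"
      unfolding \<mu>eq bh K2 k(2) by (simp add: field_simps power2_eq_square power3_eq_cube power4_eq_xxxx)
    finally show "\<mu> / 2 * (3 * h^2) - \<beta> * h^3 + 3 / 4 * (K0 + 2 * K2) * h^4 \<le> T_potential \<mu> \<beta> K0 K2 x" .
  qed (use \<theta> c0 h \<beta> K0 K(2) \<mu>(1) hex gap r(1) in auto)
qed

text \<open>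
  Here the potential of the scalar problem is even with the critical points \<open>- p\<close>, \<open>0\<close> and \<open>p\<close>, so the barrier
  \<open>x\<^sup>2 = p\<^sup>2\<close> lies exactly at the level of \<open>p\<close>. The embedding \<open>e\<close> of the line \<open>A\<^sub>2 = A\<^sub>3 = 0\<close>
  carries scalar solutions to solutions of the system.
\<close>

lemma roll_connection:
  assumes \<theta>: "\<theta> \<in> {0<..<pi / 6}" and c0: "c0 > 0" and K0: "K0 < 0" and \<mu>: "\<mu> > 0" and s: "s \<in> {1, - 1}"
  shows "\<exists>A B. heteroclinic_T \<theta> \<mu> c0 \<beta> K0 K2 (A_R s \<mu> K0, 0) (A_T, 0) A B"
proof -
  define p where "p = s * sqrt (- \<mu> / K0)"
  have "\<mu> / K0 < 0" using \<mu> K0 by (simp add: divide_pos_neg)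
  then have p2: "p^2 = - \<mu> / K0" using s by (auto simp: p_def power_mult_distrib)
  have p0: "p \<noteq> 0" using p2 \<mu> K0 by auto
  have Kp: "K0 * p^2 = - \<mu>" using p2 K0 by simp
  define m where "m = mass \<theta> 1"
  have m: "m > 0" unfolding m_def by (rule mass_pos[OF \<theta>])
  define V G where "V x = \<mu> / 2 * x^2 + K0 / 4 * x^4" and "G x = \<mu> * x + K0 * x^3" for x :: real
  have "G p = p * (\<mu> + K0 * p^2)"
    by (simp add: G_def power2_eq_square power3_eq_cube algebra_simps)
  then have Gp: "G p = 0" using Kp by simp
  interpret D: damped_gradient_system V G "\<lambda>x. m * x" "\<lambda>x. x / m" c0 m
  proof (rule damped_gradient_system.intro)
    show "(V has_derivative (\<lambda>h. G x \<bullet> h)) (at x)" for x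
      unfolding V_def[abs_def] G_def by (auto intro!: derivative_eq_intros simp: fun_eq_iff algebra_simps power3_eq_cube)
    show "\<exists>L. L-lipschitz_on (cball 0 R) G" for R
      unfolding G_def
      by (intro lipschitz_on_ex_add lipschitz_on_bounded_mult lipschitz_on_ex_power lipschitz_on_ex_const bounded_cball)
        (intro exI[of _ 1] lipschitz_onI; simp)+
    show "linear (\<lambda>x. m * x)" "linear (\<lambda>x. x / m)"
      by (rule linearI; simp add: algebra_simps add_divide_distrib)+
  qed (use m c0 in auto)
  have crit: "x = p" if "dist x p < \<bar>p\<bar>" "G x = 0" for x
  proof -
    have "x \<noteq> 0" using that(1) by auto
    have "x * (K0 * (x^2 - p^2)) = 0"
      using that(2) Kp by (simp add: G_def power2_eq_square power3_eq_cube algebra_simps)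
    then have "x^2 = p^2" using \<open>x \<noteq> 0\<close> K0 by simp
    then have "x = p \<or> x = - p" by (simp add: power2_eq_iff)
    then show ?thesis using that(1) by (auto simp: dist_real_def)
  qed
  obtain z where z: "\<And>t. (z has_vector_derivative D.field (z t)) (at t)"
    "(z \<longlongrightarrow> (p, 0)) at_bot" "(z \<longlongrightarrow> 0) at_top"
  proof (rule D.quartic_heteroclinic_connection
      [of "\<lambda>x. \<mu> * x^2" "\<lambda>_. 0" "\<lambda>x. - K0 * x^4" "\<lambda>x. x^2 / p^2" "1 / p^2" p "\<bar>p\<bar>"])
    show "V (s *\<^sub>R x) = \<mu> * x^2 / 2 * s^2 + 0 * s^3 - - K0 * x^4 / 4 * s^4" for s x
      by (simp add: V_def power_mult_distrib field_simps)
    show "V p \<le> V x" if "x^2 / p^2 = 1" for x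
    proof -
      have "x^2 = p^2" using that p0 by simp
      moreover from this have "x^4 = p^4" by (metis power2_eq_square power4_eq_xxxx mult.assoc)
      ultimately show ?thesis by (simp add: V_def)
    qed
    show "G p = 0" by (rule Gp)
    show "0 \<le> - K0 * x^4" for x :: real using K0 by (simp add: mult_nonpos_nonneg)
    show "x = p" if "dist x p < \<bar>p\<bar>" "G x = 0" for x using crit that .
    show "continuous_on UNIV (\<lambda>x. x^2 / p^2)" using p0 by (intro continuous_intros) simp
    show "0 < \<mu> * x^2" if "x \<noteq> 0" for x using that \<mu> by simp
    show "0 < 1 / p^2" using p0 by simp
  qed (use p0 in \<open>auto simp: power2_eq_square\<close>)
  define e :: "real \<Rightarrow> real ^ 3" where "e x = vector [x, 0, 0]" for x
  have e: "bounded_linear e"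
    unfolding linear_conv_bounded_linear[symmetric] e_def
    by (rule linearI) (simp_all add: vec_eq_iff forall_3)
  have ej: "e x $ 1 = x" "e x $ 2 = 0" "e x $ 3 = 0" for x by (simp_all add: e_def)
  have e0: "e 0 = 0" by (simp add: vec_eq_iff forall_3 ej)
  have Ge: "T_gradient \<mu> \<beta> K0 K2 (e x) = e (G x)" for x
    by (simp add: T_gradient_def vec_eq_iff forall_3 ej G_def power2_eq_square power3_eq_cube algebra_simps)
  define w where "w t = (e (fst (z t)), e (snd (z t)))" for t
  have E: "bounded_linear (\<lambda>v. (e (fst v), e (snd v)))"
    by (intro bounded_linear_Pair bounded_linear_compose[OF e] bounded_linear_fst bounded_linear_snd)
  have "A_R s \<mu> K0 = e p" by (simp add: A_R_def e_def p_def)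
  moreover have "\<exists>A B. heteroclinic_T \<theta> \<mu> c0 \<beta> K0 K2 (e p, 0) (A_T, 0) A B"
  proof (rule heteroclinic_T_intro[OF \<theta>])
    show "T_gradient \<mu> \<beta> K0 K2 (e p) = 0"
      by (simp add: Ge Gp e0)
    show "e p \<noteq> 0" using p0 ej(1)[of p] by (metis zero_index)
    show "(w has_vector_derivative (snd (w t),
        \<chi> j. (- c0 *\<^sub>R snd (w t) - T_gradient \<mu> \<beta> K0 K2 (fst (w t))) $ j / mass \<theta> j)) (at t)" for t
    proof -
      have "(w has_vector_derivative (e (fst (D.field (z t))), e (snd (D.field (z t))))) (at t)"
        unfolding w_def[abs_def] using bounded_linear.has_vector_derivative[OF E z(1)] by simp
      moreover have "e (snd (D.field (z t))) =
          (\<chi> j. (- c0 *\<^sub>R snd (w t) - T_gradient \<mu> \<beta> K0 K2 (fst (w t))) $ j / mass \<theta> j)"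
        unfolding D.field_def by (simp add: w_def Ge vec_eq_iff forall_3 ej m_def)
      ultimately show ?thesis by (simp add: D.field_def w_def)
    qed
    show "(w \<longlongrightarrow> (e p, 0)) at_bot"
      using bounded_linear.tendsto[OF E z(2)] by (simp add: w_def[abs_def] e0)
    show "(w \<longlongrightarrow> 0) at_top"
      using bounded_linear.tendsto[OF E z(3)] by (simp add: w_def[abs_def] e0 zero_prod_def)
  qed
  ultimately show ?thesis by simp
qed

theorem theorem4p10:
  fixes \<beta>2 K0 K2 \<theta> c0 :: real
  assumes "\<beta>2 \<ge> 0" and "K0 < 0" and "K2 < 0" and "\<theta> \<in> {0<..<pi / 6}" and "c0 > 0"
  shows "(K2 < K0 \<longrightarrow>
            (\<forall>\<mu>0 > 0. \<exists>A B. heteroclinic_T \<theta> \<mu>0 c0 \<beta>2 K0 K2 (A_H_minus \<mu>0 \<beta>2 K0 K2, 0) (A_T, 0) A B)) \<and>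
         (K2 \<in> {K0<..<0} \<longrightarrow>
            (\<forall>\<mu>0 \<in> {0<..<\<mu>1 \<beta>2 K0 K2}.
               \<exists>A B. heteroclinic_T \<theta> \<mu>0 c0 \<beta>2 K0 K2 (A_H_minus \<mu>0 \<beta>2 K0 K2, 0) (A_T, 0) A B) \<and>
            (\<forall>\<mu>0 > \<mu>1 \<beta>2 K0 K2. \<forall>s \<in> {1, - 1}.
               \<exists>A B. heteroclinic_T \<theta> \<mu>0 c0 \<beta>2 K0 K2 (A_R s \<mu>0 K0, 0) (A_T, 0) A B))"
proof (intro conjI impI allI ballI)
  fix \<mu>0 :: real assume "K2 < K0" "\<mu>0 > 0"
  then show "\<exists>A B. heteroclinic_T \<theta> \<mu>0 c0 \<beta>2 K0 K2 (A_H_minus \<mu>0 \<beta>2 K0 K2, 0) (A_T, 0) A B"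
    using assms by (intro hexagon_connection_strong_coupling)
next
  fix \<mu>0 assume "K2 \<in> {K0<..<0}" "\<mu>0 \<in> {0<..<\<mu>1 \<beta>2 K0 K2}"
  then show "\<exists>A B. heteroclinic_T \<theta> \<mu>0 c0 \<beta>2 K0 K2 (A_H_minus \<mu>0 \<beta>2 K0 K2, 0) (A_T, 0) A B"
    using assms by (intro hexagon_connection_weak_coupling) auto
next
  fix \<mu>0 s :: real assume K2: "K2 \<in> {K0<..<0}" and \<mu>0: "\<mu>1 \<beta>2 K0 K2 < \<mu>0" and s: "s \<in> {1, - 1}"
  have K: "K0 < K2" "K2 < 0" using K2 by auto
  note r = \<mu>1_eq[OF assms(2) K]
  \<comment> \<open>the threshold is nonnegative, so every larger \<open>\<mu>0\<close> is positive\<close>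
  have "\<mu>1 \<beta>2 K0 K2 \<ge> 0"
    unfolding r(5) using r(1,2) assms(2) by (intro divide_nonneg_nonneg mult_nonneg_nonneg) auto
  with \<mu>0 have "\<mu>0 > 0" by linarith
  then show "\<exists>A B. heteroclinic_T \<theta> \<mu>0 c0 \<beta>2 K0 K2 (A_R s \<mu>0 K0, 0) (A_T, 0) A B"
    by (rule roll_connection[OF assms(4,5,2) _ s])
qed

end
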